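(* Let $P_0$ and the basins $P_{0,j}$ (mutually orthogonal minimal collecting subspaces with $\sum_jP_{0,j}=P_0$) be as defined in the context. For indices $j,\ell$ let $\mathcal M_{j\ell}=\{\sigma:\sigma=P_{0,j}\sigma P_{0,\ell}\}$; $\mathcal D$ maps $\mathcal M_{j\ell}$ into itself. Let $\rho_j$ denote the unique stationary state supported in $P_{0,j}\mathcal H$. Then: \begin{enumerate} \item On $\mathcal M_{jj}$, $\mathcal D$ has exactly one eigenmatrix (up to scalar) for the eigenvalue $0$, namely $\rho_j$, and all other eigenvalues have negative real part. \item If $j\ne\ell$ and there is a unitary $U$ on $P_0\mathcal H$ commuting with $P_0HP_0$ and every $P_0h_\alpha P_0$, with $UP_{0,\ell}=P_{0,j}U$ and $U^2=P_0$, then on $\mathcal M_{j\ell}$ there is exactly one eigenmatrix (up to scalar) for the eigenvalue $0$, namely $\rho_jU$, and all other eigenvalues have negative real part. \item If $j\ne\ell$ and there are real numbers $E_j,E_\ell$ and a unitary $U$ on $P_0\mathcal H$ commuting with $P_0HP_0-(E_jP_{0,j}+E_\ell P_{0,\ell})$ and with every $P_0h_\alpha P_0$, with $UP_{0,j}=P_{0,\ell}U$, then on $\mathcal M_{j\ell}$ there is exactly one eigenmatrix (up to scalar) for an eigenvalue on the imaginary axis; this eigenvalue is $i(E_\ell-E_j)$ with eigenmatrix $\rho_jU^\dagger$, and all other eigenvalues have negative real part. \item If $j\ne\ell$ and no unitary as in item 2 or 3 exists, then all eigenvalues of $\mathcal D$ on $\mathcal M_{j\ell}$ have negative real part. \e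nd{enumerate}
   Context: Let $\mathcal H$ be a finite-dimensional complex Hilbert space, $H=H^\dagger$ and $\{h_\alpha\}$ a finite family of operators on $\mathcal H$, $\mathcal D(\rho)=-i[H,\rho]+\sum_\alpha(h_\alpha\rho h_\alpha^\dagger-\tfrac12(h_\alpha^\dagger h_\alpha\rho+\rho h_\alpha^\dagger h_\alpha))$, $\mathcal T^t=e^{t\mathcal D}$. A subspace $P\mathcal H$ ($P$ an orthogonal projector) is collecting if $\mathcal T^t(P\sigma P)=P\,\mathcal T^t(P\sigma P)\,P$ for all $t>0$ and all operators $\sigma$; it is minimal collecting if nonzero and containing no nonzero proper collecting subspace. $P_0\mathcal H$ is the span of the ranges of all density matrices $\rho$ with $\mathcal D(\rho)=0$; it is an orthogonal direct sum of minimal collecting subspaces $P_{0,j}\mathcal H$ (basins), and each $P_{0,j}$ commutes with $P_0HP_0$ and with every $P_0h_\alpha P_0$. Each basin supports exactly one stationary state $\rho_j$. *)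

theory Defs
  imports "HOL-Analysis.Analysis"
begin

text \<open>Operators on the finite-dimensional Hilbert space \<open>\<complex>^'n\<close> are
  represented as complex matrices \<open>complex^'n^'n\<close>.\<close>

type_synonym 'n cmat = "complex^'n^'n"

definition adj :: "'n::finite cmat \<Rightarrow> 'n cmat" where
  "adj A = (\<chi> i j. cnj (A $ j $ i))"

definition csc :: "complex \<Rightarrow> 'n::finite cmat \<Rightarrow> 'n cmat" where
  "csc c A = (\<chi> i j. c * A $ i $ j)"

definition mat_range :: "'n::finite cmat \<Rightarrow> (complex^'n) set" where
  "mat_range A = range (\<lambda>x. A *v x)"

definition orth_proj :: "'n::finite cmat \<Rightarrow> bool" where
  "orth_proj P \<longleftrightarrow> adj P = P \<and> P ** P = P"

definition cinner :: "complex^'n::finite \<Rightarrow> complex^'n \<Rightarrow> complex" where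
  "cinner x y = (\<Sum>i\<in>UNIV. cnj (x $ i) * y $ i)"

definition density :: "'n::finite cmat \<Rightarrow> bool" where
  "density \<rho> \<longleftrightarrow> adj \<rho> = \<rho> \<and>
     (\<forall>x. Im (cinner x (\<rho> *v x)) = 0 \<and> 0 \<le> Re (cinner x (\<rho> *v x))) \<and>
     trace \<rho> = 1"

definition unitary_on :: "'n::finite cmat \<Rightarrow> 'n cmat \<Rightarrow> bool" where
  "unitary_on P U \<longleftrightarrow> adj U ** U = P \<and> U ** adj U = P"

definition lindblad :: "'n::finite cmat \<Rightarrow> 'n cmat list \<Rightarrow> 'n cmat \<Rightarrow> 'n cmat" where
  "lindblad H hs \<rho> = csc (-\<i>) (H ** \<rho> - \<rho> ** H) +
     sum_list (map (\<lambda>h. h ** \<rho> ** adj h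
        - csc (1/2) (adj h ** h ** \<rho> + \<rho> ** adj h ** h)) hs)"

definition semigroup :: "'n::finite cmat \<Rightarrow> 'n cmat list \<Rightarrow> real \<Rightarrow> 'n cmat \<Rightarrow> 'n cmat" where
  "semigroup H hs t \<sigma> = (\<Sum>k. (t ^ k / fact k) *\<^sub>R ((lindblad H hs ^^ k) \<sigma>))"

definition collecting :: "'n::finite cmat \<Rightarrow> 'n cmat list \<Rightarrow> 'n cmat \<Rightarrow> bool" where
  "collecting H hs P \<longleftrightarrow> orth_proj P \<and>
     (\<forall>t>0. \<forall>\<sigma>. semigroup H hs t (P ** \<sigma> ** P) = P ** semigroup H hs t (P ** \<sigma> ** P) ** P)"

definition minimal_collecting :: "'n::finite cmat \<Rightarrow> 'n cmat list \<Rightarrow> 'n cmat \<Rightarrow> bool" where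
  "minimal_collecting H hs P \<longleftrightarrow> collecting H hs P \<and> P \<noteq> 0 \<and>
     (\<forall>Q. collecting H hs Q \<and> mat_range Q \<subseteq> mat_range P \<longrightarrow> Q = 0 \<or> Q = P)"

definition block :: "'n::finite cmat \<Rightarrow> 'n cmat \<Rightarrow> 'n cmat set" where
  "block Pj Pl = {\<sigma>. \<sigma> = Pj ** \<sigma> ** Pl}"

definition eigval_on :: "('n::finite cmat \<Rightarrow> 'n cmat) \<Rightarrow> 'n cmat set \<Rightarrow> complex \<Rightarrow> bool" where
  "eigval_on D M lam \<longleftrightarrow> (\<exists>\<sigma>\<in>M. \<sigma> \<noteq> 0 \<and> D \<sigma> = csc lam \<sigma>)"

definition eigspace_on :: "('n::finite cmat \<Rightarrow> 'n cmat) \<Rightarrow> 'n cmat set \<Rightarrow> complex \<Rightarrow> 'n cmat set" where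
  "eigspace_on D M lam = {\<sigma>\<in>M. D \<sigma> = csc lam \<sigma>}"

end

(* Compressed to the range of P0, the operators commute with every basin projection p.  An
   eigenvalue lam of the generator on the block from q to p is conjugate to one of the dual
   generator L, say L X = cnj lam X.  The dissipation identity
     L(adj X X) = adj(L X) X + adj X (L X) + sum over h of adj [h,X] [h,X],
   tested against a faithful stationary state of q, gives Re lam <= 0, and Re lam = 0 forces X to
   commute with all h (and, by the same argument for adj X and p, with all adj h), so that [K,X]
   is a real multiple of X for the compressed Hamiltonian K.  By minimality and Schur's lemma X is
   then a multiple of a unitary V from the range of q to that of p, and right multiplication by
   adj V maps the eigenspace to the stationary matrices of the basin p, which are the multiples
   of its stationary state.  A trace argument shows that the frequency of such an intertwiner V
   is unique, and V + adj V + (P0 - p - q) is a unitary as in item 3. *)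

theory Submission
  imports Defs
begin

subsection \<open>Matrix algebra\<close>

text \<open>Collecting only makes the range of a basin invariant under the \<open>h\<close> and
  under the drift; an \<open>h\<close> may still lead from outside \<open>P0\<close> into it, so in
  general \<open>P0\<close> reduces neither \<open>H\<close> nor the \<open>h\<close>. Hence the
  compression: the basins are orthogonal and sum to \<open>P0\<close>, so once everything outside
  \<open>P0\<close> is cut off, invariance of all of them at once becomes commutation, and on the
  blocks the generator does not see the cut. The dual generator is formed from the compressed
  operators, since the dual of the original one need not preserve a block. The passage to the dual
  rests on one fact: in finite dimension a linear map is injective as soon as its adjoint is.
  Adjoints are taken for the real inner product Re trace (adj A ** B), so that positivity arguments
  become sums of nonnegative reals that vanish, and complex scalars are conjugated when they change
  sides. Only the difference of the two energies in item 3 affects the frequency, so the unitary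
  rebuilt from an intertwiner is given the energies 0 and \<omega>.\<close>

lemma csc_nth [simp]: "csc c A $ i $ j = c * A $ i $ j"
  by (simp add: csc_def)

lemma adj_nth [simp]: "adj A $ i $ j = cnj (A $ j $ i)"
  by (simp add: adj_def)

lemma adj_adj [simp]: "adj (adj A) = A"
  by (simp add: vec_eq_iff)

lemma adj_mult: "adj (A ** B) = adj B ** adj A"
  by (simp add: vec_eq_iff matrix_matrix_mult_def mult.commute)

lemma adj_add: "adj (A + B) = adj A + adj B"
  by (simp add: vec_eq_iff)

lemma adj_diff: "adj (A - B) = adj A - adj B"
  by (simp add: vec_eq_iff)

lemma adj_csc: "adj (csc c A) = csc (cnj c) (adj A)"
  by (simp add: vec_eq_iff)

lemma adj_0 [simp]: "adj 0 = 0"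
  by (simp add: vec_eq_iff)

lemma adj_mat_1 [simp]: "adj (mat 1) = mat 1"
  by (simp add: vec_eq_iff mat_def)

lemma csc_mult_left: "csc c A ** B = csc c (A ** B)"
  by (simp add: vec_eq_iff matrix_matrix_mult_def sum_distrib_left mult.assoc)

lemma csc_mult_right: "A ** csc c B = csc c (A ** B)"
  by (simp add: vec_eq_iff matrix_matrix_mult_def sum_distrib_left mult.left_commute)

lemma csc_csc [simp]: "csc c (csc d A) = csc (c * d) A"
  by (simp add: vec_eq_iff mult.assoc)

lemma csc_add: "csc c (A + B) = csc c A + csc c B"
  by (simp add: vec_eq_iff algebra_simps)

lemma csc_diff: "csc c (A - B) = csc c A - csc c B"
  by (simp add: vec_eq_iff algebra_simps)

lemma csc_zero [simp]: "csc c 0 = 0" "csc 0 A = 0"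
  by (simp_all add: vec_eq_iff)

lemma csc_one [simp]: "csc 1 A = A"
  by (simp add: vec_eq_iff)

lemma csc_minus: "csc (- c) A = - csc c A"
  by (simp add: vec_eq_iff)

lemma csc_eq_0_iff: "csc c A = 0 \<longleftrightarrow> c = 0 \<or> A = 0"
  by (auto simp: vec_eq_iff)

lemma scaleR_csc: "r *\<^sub>R A = csc (complex_of_real r) A"
  by (simp add: vec_eq_iff) (simp add: scaleR_conv_of_real)

lemma cmat_diff_ldistrib: "A ** (B - C) = A ** B - A ** (C :: 'n::finite cmat)"
  by (simp add: vec_eq_iff matrix_matrix_mult_def algebra_simps sum_subtractf)

lemma cmat_diff_rdistrib: "(B - C) ** A = B ** A - C ** (A :: 'n::finite cmat)"
  by (simp add: vec_eq_iff matrix_matrix_mult_def algebra_simps sum_subtractf)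

lemma cmat_add_rdistrib: "(B + C) ** A = B ** A + C ** (A :: 'n::finite cmat)"
  by (simp add: vec_eq_iff matrix_matrix_mult_def algebra_simps sum.distrib)

lemma cmat_mult_zero [simp]: "A ** 0 = (0 :: 'n::finite cmat)" "0 ** A = (0 :: 'n::finite cmat)"
  by (simp_all add: vec_eq_iff matrix_matrix_mult_def)

lemma cmat_sum_ldistrib: "(A :: 'n cmat) ** (\<Sum>i\<in>I. f i) = (\<Sum>i\<in>I. A ** (f i :: 'n::finite cmat))"
  by (induction I rule: infinite_finite_induct) (auto simp: matrix_add_ldistrib)

lemmas cmat_expand =
  matrix_add_ldistrib cmat_add_rdistrib cmat_diff_ldistrib cmat_diff_rdistrib
  csc_mult_left csc_mult_right csc_add csc_diff csc_csc
  adj_mult adj_add adj_diff adj_csc adj_adj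

lemma cmat_assoc: "A ** B ** C = A ** (B ** (C :: 'n::finite cmat))"
  by (simp add: matrix_mul_assoc)

subsection \<open>Hilbert-Schmidt inner product\<close>

text \<open>This identifies the Euclidean inner product of the matrix type with the real part of the
  Hilbert-Schmidt product, so facts about Euclidean spaces apply directly to operators.\<close>

lemma inner_cmat: "inner A B = Re (trace (adj A ** B))" for A B :: "'n::finite cmat"
proof -
  have "inner A B = (\<Sum>i\<in>UNIV. \<Sum>j\<in>UNIV. inner (A $ i $ j) (B $ i $ j))"
    by (simp add: inner_vec_def)
  also have "\<dots> = (\<Sum>j\<in>UNIV. \<Sum>i\<in>UNIV. inner (A $ i $ j) (B $ i $ j))"
    by (rule sum.swap)
  finally show ?thesis
    by (simp add: trace_def matrix_matrix_mult_def inner_complex_def)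
qed

lemma inner_mult_left: "inner (A ** B) C = inner B (adj A ** C)" for A B C :: "'n::finite cmat"
  by (simp add: inner_cmat adj_mult matrix_mul_assoc)

lemma inner_mult_right: "inner (A ** B) C = inner A (C ** adj B)" for A B C :: "'n::finite cmat"
proof -
  have "trace (adj B ** (adj A ** C)) = trace (adj A ** C ** adj B)"
    by (rule trace_mul_sym)
  then show ?thesis
    by (simp add: inner_cmat adj_mult matrix_mul_assoc)
qed

lemma inner_csc: "inner (csc c A) B = inner A (csc (cnj c) B)"
proof -
  have "inner (c * a) b = inner a (cnj c * b)" for a b
    by (simp add: inner_complex_def algebra_simps)
  then show ?thesis by (simp add: inner_vec_def)
qed

lemma inner_matrix_vector: "inner x (A *v y) = inner (adj A *v x) (y :: complex^'n::finite)"
proof -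
  have "inner (a::complex) (b * c) = inner (cnj b * a) c" for a b c
    by (simp add: inner_complex_def algebra_simps)
  then show ?thesis
    by (simp add: inner_vec_def matrix_vector_mult_def inner_sum_left inner_sum_right)
       (rule sum.swap)
qed

lemma inner_columns:
  "inner A B = (\<Sum>k\<in>UNIV. inner (column k A) (column k B))" for A B :: "'n::finite cmat"
  unfolding inner_vec_def column_def by simp (rule sum.swap)

lemma column_mult: "column k (A ** B) = A *v column k (B :: 'n::finite cmat)"
  by (simp add: column_def matrix_matrix_mult_def matrix_vector_mult_def)

lemma columns_eq: "(\<And>k. column k A = column k B) \<Longrightarrow> A = (B :: 'n::finite cmat)"
  by (simp add: column_def vec_eq_iff)

subsection \<open>Positive semidefinite matrices\<close>

lemma matrix_vector_scaleR: "A *v (r *\<^sub>R x) = r *\<^sub>R (A *v (x :: complex^'n::finite))"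
  by (simp add: linear_scale)

text \<open>The real inner product sees only the real part of the quadratic form. Self-adjointness
  is what makes the imaginary part vanish, which links this notion to \<open>density\<close> in
  \<open>density_iff\<close>.\<close>

definition psd :: "'n::finite cmat \<Rightarrow> bool" where
  "psd R \<longleftrightarrow> adj R = R \<and> (\<forall>x. 0 \<le> inner x (R *v x))"

text \<open>The form at x - t y with y = R x is a quadratic polynomial in t without constant term.
  If it is nonnegative for all real t, its linear coefficient, a multiple of the squared norm of y,
  must be 0.\<close>

lemma psd_kernel:
  assumes R: "psd R" and x: "inner x (R *v x) = 0"
  shows "R *v x = 0"
proof -
  define y where "y = R *v x"
  define a where "a = inner y y"
  define b where "b = inner y (R *v y)"
  have herm: "adj R = R" and pos: "\<And>x. 0 \<le> inner x (R *v x)"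
    using R by (auto simp: psd_def)
  have xy: "inner x (R *v y) = a"
    by (simp add: inner_matrix_vector herm a_def y_def)
  have "0 \<le> - 2 * t * a + t^2 * b" for t :: real
  proof -
    have "0 \<le> inner (x - t *\<^sub>R y) (R *v (x - t *\<^sub>R y))" by (rule pos)
    also have "\<dots> = inner x (R *v x) - t * inner x (R *v y) - t * inner y (R *v x) + t^2 * b"
      by (simp add: matrix_vector_mult_diff_distrib matrix_vector_scaleR inner_diff_left
          inner_diff_right b_def power2_eq_square algebra_simps)
    also have "\<dots> = - 2 * t * a + t^2 * b"
      using x xy by (simp add: a_def y_def)
    finally show ?thesis .
  qed
  note quad = this
  have b0: "0 \<le> b" unfolding b_def by (rule pos)
  have a0: "0 \<le> a" unfolding a_def by simp
  have "a = 0"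
  proof (rule ccontr)
    assume "a \<noteq> 0"
    then have apos: "a > 0" using a0 by simp
    \<comment> \<open>Any small positive t refutes \<open>quad\<close>. The denominator b + 1 also
      covers b = 0 and ensures t * b < 2 * a.\<close>
    define t where "t = a / (b + 1)"
    have t: "t > 0" using apos b0 by (simp add: t_def)
    have "t * b < 2 * a" using apos b0 mult_nonneg_nonneg[of a b] by (simp add: t_def field_simps add_nonneg_pos)
    then have "t * (t * b) < t * (2 * a)" using t by (rule mult_strict_left_mono)
    with quad[of t] show False by (simp add: power2_eq_square algebra_simps)
  qed
  then show ?thesis by (simp add: a_def y_def)
qed

lemma inner_psd_columns:
  "inner R (W ** adj W) = (\<Sum>k\<in>UNIV. inner (R *v column k W) (column k W))"
  using inner_mult_right[of R W W] by (simp add: inner_columns column_mult)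

lemma inner_psd_nonneg: "psd R \<Longrightarrow> 0 \<le> inner R (W ** adj W)"
  unfolding inner_psd_columns
  by (intro sum_nonneg) (auto simp: psd_def inner_commute)

text \<open>The inner product is the sum of the quadratic forms of \<open>R\<close> at the columns
  of \<open>W\<close>, so each of them vanishes and \<open>psd_kernel\<close> applies. This turns a
  vanishing trace into an operator equation, here and in most positivity arguments below.\<close>

lemma psd_kernel_matrix:
  assumes R: "psd R" and W: "inner R (W ** adj W) = 0"
  shows "R ** W = 0"
proof (rule columns_eq)
  fix k
  have "\<forall>k\<in>UNIV. inner (R *v column k W) (column k W) = 0"
    using W R unfolding inner_psd_columns
    by (subst (asm) sum_nonneg_eq_0_iff) (auto simp: psd_def inner_commute)
  then have "R *v column k W = 0"
    using psd_kernel[OF R] by (simp add: inner_commute)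
  then show "column k (R ** W) = column k 0"
    by (simp add: column_mult) (simp add: column_def vec_eq_iff)
qed

lemma psd_congruence: "psd R \<Longrightarrow> psd (W ** R ** adj W)"
  unfolding psd_def
  by (auto simp: adj_mult cmat_assoc inner_matrix_vector[of _ W] matrix_vector_mul_assoc[symmetric])

lemma orth_proj_psd: "orth_proj P \<Longrightarrow> psd P"
  unfolding psd_def orth_proj_def
  by (metis inner_ge_zero inner_matrix_vector matrix_vector_mul_assoc)

lemma psd_adj_mult: "psd (adj W ** W)"
  using psd_congruence[of "mat 1" "adj W"] orth_proj_psd[of "mat 1"]
  by (simp add: orth_proj_def)

lemma inner_mat_1: "inner (mat 1) A = Re (trace (A :: 'n::finite cmat))"
  by (simp add: inner_cmat)

lemma psd_trace_nonneg:
  assumes "psd R" shows "0 \<le> Re (trace R)"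
  using inner_psd_nonneg[OF assms, of "mat 1"] by (simp add: inner_commute[of R] inner_mat_1)

lemma psd_trace_0:
  assumes "psd R" "Re (trace R) = 0" shows "R = 0"
  using psd_kernel_matrix[OF assms(1), of "mat 1"] assms(2)
  by (simp add: inner_commute[of R] inner_mat_1)

lemma trace_adj: "trace (adj A) = cnj (trace A)"
  by (simp add: trace_def)

lemma trace_hermitian_real:
  assumes "adj R = R" shows "trace R = of_real (Re (trace R))"
  using trace_adj[of R] assms by (simp add: complex_eq_iff)

lemma trace_csc: "trace (csc c A) = c * trace A"
  by (simp add: trace_def sum_distrib_left)

lemma inner_cinner: "inner x y = Re (cinner x y)"
  by (simp add: cinner_def inner_vec_def inner_complex_def)

lemma cinner_hermitian_real:
  assumes "adj R = R" shows "Im (cinner x (R *v x)) = 0"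
proof -
  have "cnj (cinner x (R *v x)) = (\<Sum>i\<in>UNIV. \<Sum>j\<in>UNIV. cnj (R $ i $ j) * cnj (x $ j) * x $ i)"
    by (simp add: cinner_def matrix_vector_mult_def sum_distrib_left mult_ac)
  also have "\<dots> = (\<Sum>j\<in>UNIV. \<Sum>i\<in>UNIV. cnj (R $ i $ j) * cnj (x $ j) * x $ i)"
    by (rule sum.swap)
  also have "\<dots> = (\<Sum>j\<in>UNIV. \<Sum>i\<in>UNIV. adj R $ j $ i * cnj (x $ j) * x $ i)"
    by simp
  also have "\<dots> = cinner x (R *v x)"
    unfolding assms by (simp add: cinner_def matrix_vector_mult_def sum_distrib_left mult_ac)
  finally show ?thesis by (simp add: complex_eq_iff)
qed

lemma density_iff: "density R \<longleftrightarrow> psd R \<and> trace R = 1"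
  using cinner_hermitian_real[of R] by (auto simp: density_def psd_def inner_cinner)

subsection \<open>Orthogonal projections\<close>

lemma orth_projD:
  fixes P A :: "'n::finite cmat"
  assumes "orth_proj P" shows "adj P = P" "P ** P = P" "P ** (P ** A) = P ** A"
  using assms by (auto simp: orth_proj_def matrix_mul_assoc)

text \<open>Kernels supply the candidate subspaces that minimality is tested on. The projection
  starts as a choice of real-orthogonal decomposition with respect to the kernel; it is complex
  linear because the kernel is closed under complex scalars.\<close>

lemma kernel_projection:
  fixes M :: "'n::finite cmat"
  obtains N where "orth_proj N" "M ** N = 0" "\<And>x. M *v x = 0 \<Longrightarrow> N *v x = x"
proof -
  define S where "S = {x. M *v x = 0}"
  have sub: "subspace S"
    by (auto simp: S_def subspace_def matrix_vector_right_distrib matrix_vector_scaleR)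
  have cS: "c *s x \<in> S" if "x \<in> S" for c x
    using that by (simp add: S_def matrix_vector_mult_def vec_eq_iff sum_distrib_left[symmetric]
        mult.left_commute[of _ c])
  have "\<exists>y. y \<in> S \<and> (\<forall>w\<in>S. inner (x - y) w = 0)" for x
  proof -
    obtain y z where "y \<in> span S" "\<And>w. w \<in> span S \<Longrightarrow> orthogonal z w" "x = y + z"
      using orthogonal_subspace_decomp_exists[of S x] by blast
    with sub have "y \<in> S \<and> (\<forall>w\<in>S. inner (x - y) w = 0)"
      by (auto simp: orthogonal_def span_eq_iff[THEN iffD2] span_base)
    then show ?thesis ..
  qed
  then obtain f where f: "\<And>x. f x \<in> S" "\<And>x w. w \<in> S \<Longrightarrow> inner (x - f x) w = 0"
    by metis
  \<comment> \<open>Additivity, complex homogeneity and fixing the kernel all follow from this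
    uniqueness of the decomposition.\<close>
  have uniq: "f x = y" if "y \<in> S" "\<And>w. w \<in> S \<Longrightarrow> inner (x - y) w = 0" for x y
  proof -
    have "f x - y \<in> S" using f(1) that(1) sub by (simp add: subspace_diff)
    then have "inner (x - y) (f x - y) = 0" "inner (x - f x) (f x - y) = 0"
      using that f by auto
    then have "inner (f x - y) (f x - y) = 0" by (simp add: inner_diff_left)
    then show ?thesis by simp
  qed
  have add: "f (x + y) = f x + f y" for x y
  proof (rule uniq)
    show "f x + f y \<in> S" using f(1) sub by (simp add: subspace_add)
    show "inner (x + y - (f x + f y)) w = 0" if "w \<in> S" for w
      using f(2)[OF that, of x] f(2)[OF that, of y] by (simp add: inner_diff_left inner_add_left)
  qed
  have scale: "f (c *s x) = c *s f x" for c x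
  proof (rule uniq)
    show "c *s f x \<in> S" using f(1) cS by blast
    have *: "inner (c *s u) w = inner u (cnj c *s w)" for u w :: "complex^'n"
    proof -
      have "inner (c * a) b = inner a (cnj c * b)" for a b :: complex
        by (simp add: inner_complex_def algebra_simps)
      then show ?thesis by (simp add: inner_vec_def)
    qed
    show "inner (c *s x - c *s f x) w = 0" if "w \<in> S" for w
      using f(2)[OF cS[OF that, of "cnj c"], of x]
      by (simp add: * inner_diff_left)
  qed
  have lin: "Vector_Spaces.linear (*s) (*s) f"
    by unfold_locales (auto simp: add scale vec.scale_right_distrib vec.scale_left_distrib)
  define N where "N = matrix f"
  have N: "N *v x = f x" for x unfolding N_def by (rule matrix_works[OF lin])
  have fix_S: "f x = x" if "x \<in> S" for x using that by (intro uniq) auto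
  have "inner (N *v x) y = inner (adj N *v x) y" for x y
  proof -
    have "inner (x - f x) (f y) = 0" "inner (y - f y) (f x) = 0" using f by auto
    then have "inner (N *v x) y = inner x (N *v y)"
      by (simp add: N inner_diff_left inner_diff_right inner_commute)
    then show ?thesis by (simp add: inner_matrix_vector)
  qed
  then have "N *v x = adj N *v x" for x
    by (metis vector_eq_ldot inner_commute)
  then have "adj N = N" by (simp add: matrix_eq)
  moreover have "N ** N = N"
    by (simp add: matrix_eq matrix_vector_mul_assoc[symmetric] N fix_S f)
  moreover have "M ** N = 0"
    using f(1) by (simp add: matrix_eq matrix_vector_mul_assoc[symmetric] N S_def)
  moreover have "N *v x = x" if "M *v x = 0" for x
    using that by (simp add: N fix_S S_def)
  ultimately show thesis using that by (simp add: orth_proj_def)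
qed

lemma matrix_fixed_by_projection:
  assumes "\<And>x. M *v x = 0 \<Longrightarrow> N *v x = x" "M ** W = 0"
  shows "N ** W = W"
  using assms by (auto simp: matrix_eq matrix_vector_mul_assoc[symmetric])

lemma orth_proj_diff:
  assumes "orth_proj p" "orth_proj q" "p ** q = q" shows "orth_proj (p - q)" "q ** p = q"
proof -
  show "q ** p = q" using assms by (metis adj_mult orth_proj_def)
  then show "orth_proj (p - q)"
    using assms by (simp add: orth_proj_def adj_diff cmat_diff_ldistrib cmat_diff_rdistrib)
qed

subsection \<open>The Lindblad generator and its invariant blocks\<close>

lemma sum_list_mult_left:
  "A ** sum_list (map f xs) = sum_list (map (\<lambda>x. A ** f x) xs)" for A :: "'n::finite cmat"
  by (induction xs) (auto simp: matrix_add_ldistrib)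

lemma sum_list_mult_right:
  "sum_list (map f xs) ** A = sum_list (map (\<lambda>x. f x ** A) xs)" for A :: "'n::finite cmat"
  by (induction xs) (auto simp: cmat_add_rdistrib)

lemma inner_sum_list: "inner A (sum_list (map f xs)) = (\<Sum>x\<leftarrow>xs. inner A (f x))"
  by (induction xs) (auto simp: inner_add_right)

lemma lindblad_Nil: "lindblad H [] s = csc (-\<i>) (H ** s - s ** H)"
  by (simp add: lindblad_def)

lemma lindblad_Cons:
  "lindblad H (h # hs) s = lindblad H hs s +
     (h ** s ** adj h - csc (1/2) (adj h ** h ** s + s ** adj h ** h))"
  by (simp add: lindblad_def)

lemma lindblad_csc: "lindblad H hs (csc c s) = csc c (lindblad H hs s)"
  by (induction hs) (simp_all add: lindblad_Nil lindblad_Cons cmat_expand mult.commute)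

lemma linear_lindblad: "linear (lindblad H hs)"
proof (rule linearI)
  show "lindblad H hs (x + y) = lindblad H hs x + lindblad H hs y" for x y
    by (induction hs) (simp_all add: lindblad_Nil lindblad_Cons cmat_expand)
qed (simp add: scaleR_csc lindblad_csc)

text \<open>This is -i times the effective non-Hermitian Hamiltonian of the evolution without jumps.
  Apart from the jump terms the generator is then one left and one right multiplication.\<close>

definition drift :: "'n::finite cmat \<Rightarrow> 'n cmat list \<Rightarrow> 'n cmat" where
  "drift H hs = csc (-\<i>) H - csc (1/2) (\<Sum>h\<leftarrow>hs. adj h ** h)"

lemma lindblad_drift:
  assumes "adj H = H"
  shows "lindblad H hs s = drift H hs ** s + s ** adj (drift H hs) + (\<Sum>h\<leftarrow>hs. h ** s ** adj h)"
proof (induction hs)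
  case Nil
  show ?case
    by (simp add: lindblad_Nil drift_def cmat_expand assms) (simp add: vec_eq_iff)
next
  case (Cons h hs)
  have "drift H (h # hs) = drift H hs - csc (1/2) (adj h ** h)"
    by (simp add: drift_def csc_add)
  then show ?case
    unfolding lindblad_Cons Cons by (simp add: cmat_expand cmat_assoc)
qed

definition block_invariant :: "'n::finite cmat \<Rightarrow> 'n cmat list \<Rightarrow> 'n cmat \<Rightarrow> bool" where
  "block_invariant H hs P \<longleftrightarrow> orth_proj P \<and>
     (\<forall>s. lindblad H hs (P ** s ** P) = P ** lindblad H hs (P ** s ** P) ** P)"

text \<open>Apply the generator to \<open>P\<close> and test it against the complementary projection
  R. The drift terms drop out and leave a sum of nonnegative terms, one for each h, so every R h P
  is 0. Multiplying by R on the left only, the drift term then remains alone and R G P = 0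
  follows.\<close>

lemma block_invariant_iff:
  assumes H: "adj H = H"
  shows "block_invariant H hs P \<longleftrightarrow> orth_proj P \<and>
    (\<forall>h\<in>set hs. h ** P = P ** h ** P) \<and> drift H hs ** P = P ** drift H hs ** P"
    (is "?L \<longleftrightarrow> _ \<and> ?h \<and> ?g")
proof
  assume L: ?L
  define R where "R = mat 1 - P"
  define G where "G = drift H hs"
  have P: "orth_proj P" and inv: "\<And>s. lindblad H hs (P ** s ** P) = P ** lindblad H hs (P ** s ** P) ** P"
    using L by (auto simp: block_invariant_def)
  note Pp = orth_projD[OF P]
  have R: "orth_proj R" unfolding R_def
    using orth_proj_diff[of "mat 1" P] P by (simp add: orth_proj_def)
  have RP: "R ** P = 0" "P ** R = 0" by (simp_all add: R_def cmat_expand Pp)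
  have DP: "lindblad H hs P = P ** lindblad H hs P ** P"
    using inv[of P] by (simp add: Pp)
  have RP': "inner R (P ** C) = 0" "inner R (C ** P) = 0" for C
    using inner_mult_left[of P R C] inner_mult_right[of R P C] by (simp_all add: Pp RP)
  have "inner R (lindblad H hs P) = 0"
    by (subst DP) (simp add: RP' cmat_assoc)
  then have "(\<Sum>h\<leftarrow>hs. inner R (h ** P ** adj h)) = 0"
    by (simp add: lindblad_drift[OF H] inner_add_right RP' inner_sum_list)
  moreover have WW: "h ** P ** adj h = (h ** P) ** adj (h ** P)" for h
    by (simp add: adj_mult Pp cmat_assoc)
  ultimately have "\<forall>h\<in>set hs. inner R ((h ** P) ** adj (h ** P)) = 0"
    using inner_psd_nonneg[OF orth_proj_psd[OF R]]
    by (subst (asm) sum_list_nonneg_eq_0_iff) (auto simp: WW)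
  then have RhP: "R ** (h ** P) = 0" if "h \<in> set hs" for h
    using psd_kernel_matrix[OF orth_proj_psd[OF R]] that by blast
  then have h: ?h by (simp add: R_def cmat_expand cmat_assoc)
  have "R ** lindblad H hs P = 0"
    by (subst DP) (simp add: matrix_mul_assoc RP)
  moreover have "R ** (\<Sum>h\<leftarrow>hs. h ** P ** adj h) = 0"
    using RhP by (induction hs) (auto simp: matrix_mul_assoc matrix_add_ldistrib)
  ultimately have "R ** (G ** P) = 0"
    by (simp add: lindblad_drift[OF H] matrix_add_ldistrib matrix_mul_assoc RP G_def)
  then have ?g by (simp add: R_def G_def cmat_expand cmat_assoc)
  with P h show "orth_proj P \<and> ?h \<and> ?g" by blast
next
  assume "orth_proj P \<and> ?h \<and> ?g"
  then have P: "orth_proj P" and h: ?h and g: ?g by auto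
  define G where "G = drift H hs"
  note Pp = orth_projD[OF P]
  have g: "G ** P = P ** (G ** P)" using g by (simp add: G_def cmat_assoc)
  have g': "P ** adj G = P ** (adj G ** P)"
    using arg_cong[OF g, of adj] by (simp add: adj_mult Pp cmat_assoc)
  have h': "P ** adj h = P ** (adj h ** P)" if "h \<in> set hs" for h
  proof -
    have "h ** P = P ** h ** P" using that h by blast
    from arg_cong[OF this, of adj] show ?thesis by (simp add: adj_mult Pp cmat_assoc)
  qed
  have "lindblad H hs (P ** s ** P) = P ** lindblad H hs (P ** s ** P) ** P" for s
  proof -
    have 1: "P ** (G ** (P ** s ** P)) ** P = G ** (P ** s ** P)"
      using g by (metis (no_types, lifting) Pp(2) matrix_mul_assoc)
    have 2: "P ** ((P ** s ** P) ** adj G) ** P = (P ** s ** P) ** adj G"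
      using g' by (metis (no_types, lifting) Pp(2) matrix_mul_assoc)
    have "P ** (h ** (P ** s ** P) ** adj h) ** P = h ** (P ** s ** P) ** adj h" if "h \<in> set hs" for h
    proof -
      have "P ** (h ** (P ** s ** P) ** adj h) ** P = (P ** h ** P) ** s ** (P ** (adj h ** P))"
        by (simp add: cmat_assoc)
      also have "\<dots> = (h ** P) ** s ** (P ** adj h)" using h h' that by metis
      finally show ?thesis by (simp add: cmat_assoc)
    qed
    then have 3: "map (\<lambda>h. P ** (h ** (P ** s ** P) ** adj h) ** P) hs = map (\<lambda>h. h ** (P ** s ** P) ** adj h) hs"
      by (intro map_cong) auto
    show ?thesis
      unfolding lindblad_drift[OF H] G_def[symmetric] matrix_add_ldistrib cmat_add_rdistrib 1 2
        sum_list_mult_left sum_list_mult_right 3 ..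
  qed
  with P show ?L by (simp add: block_invariant_def)
qed

section \<open>Invariance under the semigroup versus invariance under the generator\<close>

lemma summable_semigroup:
  "summable (\<lambda>k. (t ^ k / fact k) *\<^sub>R ((lindblad H hs ^^ k) s))"
proof -
  obtain B where B: "B > 0" "\<And>x. norm (lindblad H hs x) \<le> B * norm x"
    using linear_bounded_pos[OF linear_lindblad] by blast
  have pow: "norm ((lindblad H hs ^^ k) s) \<le> B ^ k * norm s" for k
  proof (induction k)
    case (Suc k)
    have "norm ((lindblad H hs ^^ Suc k) s) \<le> B * norm ((lindblad H hs ^^ k) s)"
      using B by simp
    also have "\<dots> \<le> B * (B ^ k * norm s)"
      using Suc B by (intro mult_left_mono) auto
    finally show ?case by simp
  qed simp
  show ?thesis
  proof (rule summable_comparison_test')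
    show "summable (\<lambda>k. norm s * (inverse (fact k) * (\<bar>t\<bar> * B) ^ k))"
      by (intro summable_mult summable_exp)
    show "norm ((t ^ k / fact k) *\<^sub>R ((lindblad H hs ^^ k) s))
        \<le> norm s * (inverse (fact k) * (\<bar>t\<bar> * B) ^ k)" if "k \<ge> 0" for k
      using mult_left_mono[OF pow[of k], of "\<bar>t\<bar> ^ k / fact k"]
      by (simp add: power_mult_distrib power_abs divide_inverse abs_mult mult_ac)
  qed
qed

lemma linear_compression: "linear (\<lambda>s. s - P ** s ** P)" for P :: "'n::finite cmat"
  by (rule linearI) (simp_all add: cmat_expand scaleR_csc)

text \<open>From the semigroup to the generator, the first-order coefficient of a power series that
  vanishes for t > 0 is read off at 0. Conversely all powers of the generator stay in the corner,
  hence so does the series.\<close>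

lemma collecting_iff: "collecting H hs P \<longleftrightarrow> block_invariant H hs P"
proof
  assume C: "collecting H hs P"
  then have P: "orth_proj P" by (simp add: collecting_def)
  note Pp = orth_projD[OF P]
  define F where "F s = s - P ** s ** P" for s
  have F: "bounded_linear F"
    unfolding F_def using linear_compression by (simp add: linear_conv_bounded_linear)
  have "F (lindblad H hs s) = 0" if s: "s = P ** s ** P" for s
  proof (rule ccontr)
    assume ne: "F (lindblad H hs s) \<noteq> 0"
    \<comment> \<open>Pairing with the offending value itself makes \<open>c 1\<close> its squared
      norm, which would be nonzero.\<close>
    define b where "b = F (lindblad H hs s)"
    define c where "c k = inner (F ((lindblad H hs ^^ k) s)) b / fact k" for k
    define g where "g t = inner (F (semigroup H hs t s)) b" for t
    have "bounded_linear (\<lambda>x. inner (F x) b)"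
      using bounded_linear_compose[OF bounded_linear_inner_left F] by simp
    from bounded_linear.sums[OF this summable_sums[OF summable_semigroup]]
    have sums: "(\<lambda>k. c k * t ^ k) sums g t" for t
      by (simp add: c_def g_def semigroup_def linear_scale[OF bounded_linear.linear[OF F]] field_simps)
    have c0: "c 0 = 0" using s by (simp add: c_def F_def)
    have g0: "g t = 0" if "t > 0" for t
      using C that s by (metis F_def collecting_def g_def inner_zero_left right_minus_eq)
    \<comment> \<open>Dividing by t shifts the coefficients. At t = 0 the quotient must be given the
      value \<open>c 1\<close>, the sum of the shifted series there.\<close>
    have "(\<lambda>k. c (Suc k) * t ^ k) sums (if t = 0 then c 1 else g t / t)" for t
    proof (cases "t = 0")
      case True
      then show ?thesis using powser_sums_zero[of "\<lambda>k. c (Suc k)"] by simp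
    next
      case False
      have "(\<lambda>k. c (Suc k) * t ^ Suc k) sums g t"
        using sums[of t] c0 by (subst sums_Suc_iff) simp
      from sums_divide[OF this, of t] False show ?thesis by simp
    qed
    then have "((\<lambda>t. if t = 0 then c 1 else g t / t) \<longlongrightarrow> c (Suc 0)) (at 0)"
      by (intro powser_limit_0[of 1 "\<lambda>k. c (Suc k)"]) auto
    then have "((\<lambda>t. if t = 0 then c 1 else g t / t) \<longlongrightarrow> c 1) (at_right 0)"
      by (simp add: filterlim_at_split)
    moreover have "((\<lambda>t. if t = 0 then c 1 else g t / t) \<longlongrightarrow> 0) (at_right 0)"
      by (rule tendsto_eventually) (auto simp: eventually_at_right_field g0 intro!: exI[of _ 1])
    ultimately have "c 1 = 0" using tendsto_unique trivial_limit_at_right_real by blast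
    then show False using ne by (simp add: c_def b_def)
  qed
  then show "block_invariant H hs P"
    using P by (simp add: block_invariant_def F_def)
      (metis (no_types, lifting) Pp(2) matrix_mul_assoc right_minus_eq)
next
  assume I: "block_invariant H hs P"
  then have P: "orth_proj P" by (simp add: block_invariant_def)
  note Pp = orth_projD[OF P]
  define F where "F s = s - P ** s ** P" for s
  have F: "bounded_linear F"
    unfolding F_def using linear_compression by (simp add: linear_conv_bounded_linear)
  have "F (semigroup H hs t s) = 0" if s: "s = P ** s ** P" for s t
  proof -
    have pow: "(lindblad H hs ^^ k) s = P ** (lindblad H hs ^^ k) s ** P" for k
    proof (induction k)
      case (Suc k)
      then show ?case using I unfolding block_invariant_def by (metis funpow.simps(2) o_apply)
    qed (use s in simp)
    have "F ((lindblad H hs ^^ k) s) = 0" for k using pow[of k] by (simp add: F_def)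
    then have "F ((t ^ k / fact k) *\<^sub>R (lindblad H hs ^^ k) s) = 0" for k
      by (simp add: linear_scale[OF bounded_linear.linear[OF F]])
    then show ?thesis
      unfolding semigroup_def bounded_linear.suminf[OF F summable_semigroup] by simp
  qed
  moreover have "P ** s ** P = P ** (P ** s ** P) ** P" for s
    by (simp add: Pp matrix_mul_assoc) (simp add: Pp cmat_assoc)
  ultimately have "F (semigroup H hs t (P ** s ** P)) = 0" for s t by blast
  then show "collecting H hs P" using P by (simp add: collecting_def F_def)
qed

lemma minimal_collectingD:
  assumes "minimal_collecting H hs P"
  shows "orth_proj P" "block_invariant H hs P" "P \<noteq> 0"
    "\<And>Q. block_invariant H hs Q \<Longrightarrow> P ** Q = Q \<Longrightarrow> Q = 0 \<or> Q = P"
proof -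
  show "orth_proj P" "block_invariant H hs P" "P \<noteq> 0"
    using assms by (auto simp: minimal_collecting_def collecting_iff block_invariant_def)
  fix Q assume "block_invariant H hs Q" "P ** Q = Q"
  moreover from this(2) have "mat_range Q \<subseteq> mat_range P"
    unfolding mat_range_def by (auto simp: image_iff) (metis matrix_vector_mul_assoc)
  ultimately show "Q = 0 \<or> Q = P"
    using assms by (auto simp: minimal_collecting_def collecting_iff)
qed

subsection \<open>The dual generator and the dissipation identity\<close>

definition lindblad_dual :: "'n::finite cmat \<Rightarrow> 'n cmat list \<Rightarrow> 'n cmat \<Rightarrow> 'n cmat" where
  "lindblad_dual H hs X = csc \<i> (H ** X - X ** H) +
     (\<Sum>h\<leftarrow>hs. adj h ** X ** h - csc (1/2) (adj h ** h ** X + X ** adj h ** h))"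

lemma lindblad_dual_Nil: "lindblad_dual H [] X = csc \<i> (H ** X - X ** H)"
  by (simp add: lindblad_dual_def)

lemma lindblad_dual_Cons:
  "lindblad_dual H (h # hs) X = lindblad_dual H hs X +
     (adj h ** X ** h - csc (1/2) (adj h ** h ** X + X ** adj h ** h))"
  by (simp add: lindblad_dual_def)

lemma inner_lindblad:
  assumes "adj H = H"
  shows "inner (lindblad H hs s) X = inner s (lindblad_dual H hs X)"
proof (induction hs)
  case Nil
  show ?case
    by (simp add: lindblad_Nil lindblad_dual_Nil inner_csc inner_diff_left inner_diff_right
        inner_mult_left[of H] inner_mult_right[of _ H] assms cmat_expand)
next
  case (Cons h hs)
  show ?case
    by (simp add: lindblad_Cons lindblad_dual_Cons Cons inner_csc inner_diff_left inner_diff_right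
        inner_add_left inner_add_right
        inner_mult_left[of h] inner_mult_left[of "adj h ** h"]
        inner_mult_right[of _ h] inner_mult_right[of _ "adj h"] cmat_expand matrix_mul_assoc)
qed

lemma lindblad_dual_csc: "lindblad_dual H hs (csc c X) = csc c (lindblad_dual H hs X)"
  by (induction hs) (simp_all add: lindblad_dual_Nil lindblad_dual_Cons cmat_expand mult.commute)

lemma linear_lindblad_dual: "linear (lindblad_dual H hs)"
proof (rule linearI)
  show "lindblad_dual H hs (x + y) = lindblad_dual H hs x + lindblad_dual H hs y" for x y
    by (induction hs) (simp_all add: lindblad_dual_Nil lindblad_dual_Cons cmat_expand)
qed (simp add: scaleR_csc lindblad_dual_csc)

lemma lindblad_dual_adj:
  assumes "adj H = H" shows "adj (lindblad_dual H hs X) = lindblad_dual H hs (adj X)"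
  by (induction hs)
     (simp_all add: lindblad_dual_Nil lindblad_dual_Cons cmat_expand cmat_assoc assms add.commute,
      simp add: vec_eq_iff)

text \<open>The Hamiltonian part is a derivation and contributes no defect. Each h fails the product
  rule by exactly the square of its commutator with X, so the list can be treated one h at a
  time.\<close>

lemma dissipation_identity:
  assumes "adj H = H"
  shows "lindblad_dual H hs (adj X ** X) =
    adj (lindblad_dual H hs X) ** X + adj X ** lindblad_dual H hs X +
    (\<Sum>h\<leftarrow>hs. adj (h ** X - X ** h) ** (h ** X - X ** h))"
proof (induction hs)
  case Nil
  show ?case
    by (simp add: lindblad_dual_Nil cmat_expand cmat_assoc assms) (simp add: vec_eq_iff)
next
  case (Cons h hs)
  show ?case
    unfolding lindblad_dual_Cons Cons sum_list.Cons list.map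
    by (simp add: cmat_expand cmat_assoc) (simp add: vec_eq_iff algebra_simps)
qed

definition reduces :: "'n::finite cmat \<Rightarrow> 'n cmat \<Rightarrow> 'n cmat list \<Rightarrow> bool" where
  "reduces p K hs \<longleftrightarrow> orth_proj p \<and> adj K = K \<and> K ** p = p ** K \<and> (\<forall>h\<in>set hs. h ** p = p ** h)"

lemma commute_adj:
  assumes "h ** p = p ** h" shows "adj h ** adj p = adj p ** adj h"
  using arg_cong[OF assms, of adj] by (simp add: adj_mult)

lemma commute_drift:
  assumes "K ** M = M ** K"
    and "\<And>h. h \<in> set hs \<Longrightarrow> h ** M = M ** h"
    and "\<And>h. h \<in> set hs \<Longrightarrow> adj h ** M = M ** adj h"
  shows "drift K hs ** M = M ** drift K hs"
proof -
  have "(\<Sum>h\<leftarrow>hs. adj h ** h ** M) = (\<Sum>h\<leftarrow>hs. M ** (adj h ** h))"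
    using assms(2,3) by (intro arg_cong[where f = sum_list] map_cong) (auto simp: matrix_mul_assoc, metis matrix_mul_assoc)
  then show ?thesis
    by (simp add: drift_def cmat_expand assms(1) sum_list_mult_left sum_list_mult_right)
qed

lemma reducesD:
  fixes p A :: "'n::finite cmat"
  assumes "reduces p K hs"
  shows "orth_proj p" "adj K = K" "adj p = p" "p ** p = p" "p ** (p ** A) = p ** A"
    "K ** p = p ** K" "K ** (p ** A) = p ** (K ** A)"
    "h \<in> set hs \<Longrightarrow> h ** p = p ** h" "h \<in> set hs \<Longrightarrow> h ** (p ** A) = p ** (h ** A)"
    "h \<in> set hs \<Longrightarrow> adj h ** p = p ** adj h"
    "h \<in> set hs \<Longrightarrow> adj h ** (p ** A) = p ** (adj h ** A)"
proof -
  show *: "orth_proj p" "adj K = K" "adj p = p" "p ** p = p" "p ** (p ** A) = p ** A"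
    "K ** p = p ** K" using assms by (auto simp: reduces_def orth_proj_def matrix_mul_assoc)
  then show "K ** (p ** A) = p ** (K ** A)" by (simp add: matrix_mul_assoc)
  assume h: "h \<in> set hs"
  then show h': "h ** p = p ** h" using assms by (simp add: reduces_def)
  then show "h ** (p ** A) = p ** (h ** A)" by (simp add: matrix_mul_assoc)
  show h'': "adj h ** p = p ** adj h" using commute_adj[OF h'] * by simp
  then show "adj h ** (p ** A) = p ** (adj h ** A)" by (simp add: matrix_mul_assoc)
qed

lemma reduces_drift:
  assumes "reduces p K hs"
  shows "drift K hs ** p = p ** drift K hs" "adj (drift K hs) ** p = p ** adj (drift K hs)"
proof -
  show *: "drift K hs ** p = p ** drift K hs"
    using reducesD[OF assms] by (intro commute_drift) auto
  show "adj (drift K hs) ** p = p ** adj (drift K hs)"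
    using commute_adj[OF *] reducesD(3)[OF assms] by simp
qed

lemma reduces_lindblad:
  assumes p: "reduces p K hs" and q: "reduces q K hs"
  shows "lindblad K hs (p ** s ** q) = p ** lindblad K hs s ** q"
  using assms
proof (induction hs)
  case Nil
  then show ?case using reducesD[OF Nil(1)] reducesD[OF Nil(2)]
    by (simp add: lindblad_Nil cmat_expand cmat_assoc)
next
  case (Cons h hs)
  have "reduces p K hs" "reduces q K hs" using Cons.prems by (auto simp: reduces_def)
  then show ?case
    using Cons.IH reducesD[OF Cons(2)] reducesD[OF Cons(3)]
    by (simp add: lindblad_Cons cmat_expand cmat_assoc)
qed

lemma reduces_lindblad_dual:
  assumes p: "reduces p K hs" and q: "reduces q K hs"
  shows "lindblad_dual K hs (p ** s ** q) = p ** lindblad_dual K hs s ** q"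
  using assms
proof (induction hs)
  case Nil
  then show ?case using reducesD[OF Nil(1)] reducesD[OF Nil(2)]
    by (simp add: lindblad_dual_Nil cmat_expand cmat_assoc)
next
  case (Cons h hs)
  have "reduces p K hs" "reduces q K hs" using Cons.prems by (auto simp: reduces_def)
  then show ?case
    using Cons.IH reducesD[OF Cons(2)] reducesD[OF Cons(3)]
    by (simp add: lindblad_dual_Cons cmat_expand cmat_assoc)
qed

text \<open>An injective \<open>g\<close> is surjective in finite dimension. Writing x = g y gives
  inner x x = inner (f x) y = 0. Read contrapositively, a kernel vector of \<open>f\<close> forces
  one of \<open>g\<close>.\<close>

lemma injective_if_adjoint_injective:
  fixes f g :: "'a::euclidean_space \<Rightarrow> 'a"
  assumes "linear g" "\<And>x y. inner (f x) y = inner x (g y)" "\<And>y. g y = 0 \<Longrightarrow> y = 0" "f x = 0"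
  shows "x = 0"
proof -
  have "inj g" using assms(1,3) by (simp add: linear_injective_0)
  then have "surj g" using assms(1) by (simp add: linear_injective_imp_surjective)
  then obtain y where "x = g y" by auto
  then have "inner x x = inner (f x) y" using assms(2) by simp
  then show ?thesis using assms(4) by simp
qed

lemma linear_block: "linear (\<lambda>s. p ** s ** q)" for p q :: "'n::finite cmat"
  by (rule linearI) (simp_all add: cmat_expand scaleR_csc)

lemma linear_csc: "linear (csc c)"
  by (rule linearI) (simp_all add: cmat_expand scaleR_csc mult.commute)

lemma inner_block:
  "adj p = p \<Longrightarrow> adj q = q \<Longrightarrow> inner (p ** s ** q) X = inner s (p ** X ** q)"
  for p q :: "'n::finite cmat"
  by (simp add: inner_mult_right[of _ q] inner_mult_left[of p] cmat_assoc)

lemma dual_eigenvector: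
  assumes p: "reduces p K hs" and q: "reduces q K hs"
    and s: "s = p ** s ** q" "s \<noteq> 0" "lindblad K hs s = csc lam s"
  obtains X where "X = p ** X ** q" "X \<noteq> 0" "lindblad_dual K hs X = csc (cnj lam) X"
proof -
  note pD = reducesD[OF p] and qD = reducesD[OF q]
  \<comment> \<open>\<open>f\<close> is the generator minus \<open>lam\<close> on the block and the
    identity on its orthogonal complement; \<open>g\<close> is its adjoint. This extension to all
    matrices has its kernel inside the block.\<close>
  define f where "f s = lindblad K hs (p ** s ** q) - csc lam (p ** s ** q) + s - p ** s ** q" for s
  define g where "g X = lindblad_dual K hs (p ** X ** q) - csc (cnj lam) (p ** X ** q) + X - p ** X ** q" for X
  have "linear g" unfolding g_def
    by (intro linear_compose_sub linear_compose_add linear_ident linear_block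
        linear_compose[OF linear_block linear_lindblad_dual, unfolded o_def]
        linear_compose[OF linear_block linear_csc, unfolded o_def])
  moreover have "inner (f x) y = inner x (g y)" for x y
  proof -
    have "inner (lindblad K hs (p ** x ** q)) y = inner x (lindblad_dual K hs (p ** y ** q))"
      unfolding inner_lindblad[OF pD(2)] reduces_lindblad_dual[OF p q]
      by (simp add: inner_block pD qD)
    moreover have "inner (csc lam (p ** x ** q)) y = inner x (csc (cnj lam) (p ** y ** q))"
      by (simp add: inner_csc inner_block pD qD csc_mult_left csc_mult_right)
    ultimately show ?thesis
      by (simp add: f_def g_def inner_block pD qD inner_add_left inner_diff_left
          inner_add_right inner_diff_right)
  qed
  moreover have "f s = 0" using s by (simp add: f_def)
  ultimately obtain X where X: "g X = 0" "X \<noteq> 0"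
    using injective_if_adjoint_injective[of g f s] s(2) by blast
  have pp: "p ** (p ** A ** q) ** q = p ** A ** q" for A
    by (simp add: cmat_assoc pD qD)
  \<comment> \<open>Compressing to the block isolates the eigenvalue equation; what is left of g X =
    0 then places X in the block.\<close>
  have "p ** g X ** q = lindblad_dual K hs (p ** X ** q) - csc (cnj lam) (p ** X ** q)"
    unfolding g_def reduces_lindblad_dual[OF p q] cmat_expand pp by simp
  then have 1: "lindblad_dual K hs (p ** X ** q) = csc (cnj lam) (p ** X ** q)"
    using X by simp
  then have 2: "X = p ** X ** q" using X(1) by (simp add: g_def)
  show thesis using that[OF 2 X(2)] 1 2 by metis
qed

subsection \<open>Irreducible blocks\<close>

text \<open>Quantifying over matrices rather than vectors matches the conclusion of
  \<open>psd_kernel_matrix\<close>.\<close>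

definition faithful_on :: "'n::finite cmat \<Rightarrow> 'n cmat \<Rightarrow> bool" where
  "faithful_on p R \<longleftrightarrow> psd R \<and> (\<forall>W :: 'n cmat. p ** W = W \<and> R ** W = 0 \<longrightarrow> W = 0)"

lemma dissipation_bound:
  fixes X :: "'n::finite cmat"
  assumes p: "reduces p K hs" and q: "reduces q K hs"
    and R: "faithful_on q R" "lindblad K hs R = 0"
    and X: "X = p ** X ** q" "X \<noteq> 0" "lindblad_dual K hs X = csc \<mu> X" "Re \<mu> \<ge> 0"
  shows "Re \<mu> = 0" "\<And>h. h \<in> set hs \<Longrightarrow> h ** X = X ** h"
proof -
  note pD = reducesD[OF p] and qD = reducesD[OF q]
  have R': "psd R" "\<And>W :: 'n cmat. q ** W = W \<Longrightarrow> R ** W = 0 \<Longrightarrow> W = 0"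
    using R(1) by (simp_all add: faithful_on_def)
  define Z where "Z h = h ** X - X ** h" for h
  define a where "a = inner R (adj X ** X)"
  have Xq: "X ** q = X" "X ** (q ** A) = X ** A" for A
    using X(1) by (metis qD(4) matrix_mul_assoc)+
  have nonneg: "0 \<le> inner R (adj W ** W)" for W
    using inner_psd_nonneg[OF R'(1), of "adj W"] by simp
  have zero: "W = 0" if "inner R (adj W ** W) = 0" "W ** q = W" for W
  proof -
    have "R ** adj W = 0" using psd_kernel_matrix[OF R'(1), of "adj W"] that(1) by simp
    moreover have "q ** adj W = adj W" using arg_cong[OF that(2), of adj] by (simp add: adj_mult qD)
    ultimately have "adj W = 0" using R'(2) by blast
    then show ?thesis by (metis adj_adj adj_0)
  qed
  have apos: "a > 0"
    using nonneg[of X] zero[of X] Xq X(2) by (force simp: a_def)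
  \<comment> \<open>The commutators keep the right support q because h commutes with q. Without
    this, faithfulness of \<open>R\<close> on q could not detect them.\<close>
  have Zq: "Z h ** q = Z h" if "h \<in> set hs" for h
    using that by (simp add: Z_def cmat_expand cmat_assoc Xq qD)
  have "0 = inner (lindblad K hs R) (adj X ** X)" using R by simp
  also have "\<dots> = inner R (lindblad_dual K hs (adj X ** X))" by (rule inner_lindblad[OF pD(2)])
  also have "lindblad_dual K hs (adj X ** X) =
      csc (cnj \<mu> + \<mu>) (adj X ** X) + (\<Sum>h\<leftarrow>hs. adj (Z h) ** Z h)"
    unfolding dissipation_identity[OF pD(2)] X(3) Z_def
    by (simp add: cmat_expand) (simp add: vec_eq_iff algebra_simps)
  also have "cnj \<mu> + \<mu> = complex_of_real (2 * Re \<mu>)" by (simp add: complex_eq_iff)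
  also have "inner R (csc (complex_of_real (2 * Re \<mu>)) (adj X ** X) + (\<Sum>h\<leftarrow>hs. adj (Z h) ** Z h)) =
      2 * Re \<mu> * a + (\<Sum>h\<leftarrow>hs. inner R (adj (Z h) ** Z h))"
    by (simp only: scaleR_csc[symmetric] inner_add_right inner_scaleR_right inner_sum_list a_def)
  \<comment> \<open>Stationarity of \<open>R\<close> makes the total vanish, while both summands are
    nonnegative; this yields both conclusions at once.\<close>
  finally have eq: "2 * Re \<mu> * a + (\<Sum>h\<leftarrow>hs. inner R (adj (Z h) ** Z h)) = 0" by simp
  have s0: "0 \<le> (\<Sum>h\<leftarrow>hs. inner R (adj (Z h) ** Z h))"
    using nonneg by (intro sum_list_nonneg) auto
  have "0 \<le> 2 * Re \<mu> * a" using X(4) apos by simp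
  with eq s0 have 0: "2 * Re \<mu> * a = 0" "(\<Sum>h\<leftarrow>hs. inner R (adj (Z h) ** Z h)) = 0" by linarith+
  then show "Re \<mu> = 0" using apos by simp
  have "\<forall>h\<in>set hs. inner R (adj (Z h) ** Z h) = 0"
    using 0(2) nonneg by (subst (asm) sum_list_nonneg_eq_0_iff) auto
  then show "h ** X = X ** h" if "h \<in> set hs" for h
    using zero[of "Z h"] Zq that by (auto simp: Z_def)
qed

lemma dual_eigenvector_commutes:
  assumes p: "reduces p K hs" and q: "reduces q K hs"
    and Rp: "faithful_on p Rp" "lindblad K hs Rp = 0"
    and Rq: "faithful_on q Rq" "lindblad K hs Rq = 0"
    and X: "X = p ** X ** q" "X \<noteq> 0" "lindblad_dual K hs X = csc \<mu> X" "Re \<mu> \<ge> 0"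
  shows "Re \<mu> = 0" "\<And>h. h \<in> set hs \<Longrightarrow> h ** X = X ** h"
    "\<And>h. h \<in> set hs \<Longrightarrow> adj h ** X = X ** adj h"
    "K ** X - X ** K = csc (- \<i> * \<mu>) X"
proof -
  note pD = reducesD[OF p] and qD = reducesD[OF q]
  show "Re \<mu> = 0" and 1: "\<And>h. h \<in> set hs \<Longrightarrow> h ** X = X ** h"
    by (fact dissipation_bound[OF p q Rq X])+
  have X': "adj X = q ** adj X ** p"
    using arg_cong[OF X(1), of adj] by (simp add: adj_mult pD qD cmat_assoc)
  have ne: "adj X \<noteq> 0" using X(2) by (metis adj_adj adj_0)
  have "lindblad_dual K hs (adj X) = csc (cnj \<mu>) (adj X)"
    using lindblad_dual_adj[OF pD(2), of hs X] X(3) by (simp add: adj_csc)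
  then have "h ** adj X = adj X ** h" if "h \<in> set hs" for h
    using dissipation_bound(2)[OF q p Rp X' ne] X(4) that by simp
  then show 2: "adj h ** X = X ** adj h" if "h \<in> set hs" for h
    using that commute_adj[of h "adj X"] by simp
  \<comment> \<open>An h commuting with X together with its adjoint has no dissipative effect on X.
    The induction runs over sublists so that the commutation facts for \<open>hs\<close> stay
    fixed.\<close>
  have "lindblad_dual K hs' X = csc \<i> (K ** X - X ** K)" if "set hs' \<subseteq> set hs" for hs'
    using that
  proof (induction hs')
    case (Cons h hs')
    then have h: "h ** X = X ** h" "adj h ** X = X ** adj h" using 1 2 by auto
    have "adj h ** (h ** X) = X ** (adj h ** h)" "adj h ** (X ** h) = X ** (adj h ** h)"
      using h by (metis matrix_mul_assoc)+
    then show ?case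
      using Cons by (simp add: lindblad_dual_Cons cmat_assoc csc_add) (simp add: vec_eq_iff)
  qed (simp add: lindblad_dual_Nil)
  then have "csc \<i> (K ** X - X ** K) = csc \<mu> X" using X(3) by simp
  then have "csc (- \<i>) (csc \<i> (K ** X - X ** K)) = csc (- \<i>) (csc \<mu> X)" by simp
  then show "K ** X - X ** K = csc (- \<i> * \<mu>) X" by simp
qed

text \<open>The Rayleigh quotient of Y attains its maximum c on the unit sphere of the range of q.
  Then c q - Y is positive semidefinite and its form vanishes at the maximiser, so
  \<open>psd_kernel\<close> makes that vector an eigenvector.\<close>

lemma hermitian_eigenvector:
  assumes q: "orth_proj q" "q \<noteq> 0" and Y: "adj Y = Y" "Y = q ** Y ** q"
  obtains c x where "x \<noteq> 0" "q *v x = x" "Y *v x = csc (of_real c) q *v x"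
proof -
  note qD = orth_projD[OF q(1)]
  define S where "S = {x. q *v x = x \<and> norm x = 1}"
  have qq: "q *v (q *v x) = q *v x" for x by (simp add: matrix_vector_mul_assoc qD)
  have "compact S"
  proof -
    have "S = {x. q *v x = x} \<inter> sphere 0 1" by (auto simp: S_def)
    moreover have "closed {x. q *v x = x}"
      by (intro closed_Collect_eq linear_continuous_on bounded_linear_ident) auto
    ultimately show ?thesis by (simp add: closed_Int_compact)
  qed
  moreover have normalize: "(1 / norm x) *\<^sub>R x \<in> S" if "q *v x = x" "x \<noteq> 0" for x
    using that by (simp add: S_def matrix_vector_scaleR)
  obtain x where "q *v x \<noteq> 0" using q(2) by (metis matrix_eq matrix_vector_mult_0)
  then have "S \<noteq> {}" using normalize[of "q *v x"] qq by auto
  moreover have "continuous_on S (\<lambda>x. inner x (Y *v x))"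
    by (intro continuous_intros linear_continuous_on) auto
  ultimately obtain x where x: "x \<in> S" "\<And>y. y \<in> S \<Longrightarrow> inner y (Y *v y) \<le> inner x (Y *v x)"
    using continuous_attains_sup by metis
  define c where "c = inner x (Y *v x)"
  define T where "T = csc (complex_of_real c) q - Y"
  have cq: "csc (complex_of_real c) q *v y = c *\<^sub>R (q *v y)" for y
    
    by (simp add: vec_eq_iff matrix_vector_mult_def)
      (simp add: scaleR_conv_of_real sum_distrib_left mult.assoc)
  have Tq: "T = q ** T ** q"
    using Y(2)[symmetric] by (simp add: T_def cmat_expand qD)
  have adjT: "adj T = T" by (simp add: T_def cmat_expand qD Y(1))
  have "0 \<le> inner y (T *v y)" for y
  proof -
    define z where "z = q *v y"
    have qz: "q *v z = z" by (simp add: z_def qq)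
    have "inner y (T *v y) = inner y (q *v (T *v (q *v y)))"
      by (subst Tq) (simp add: matrix_vector_mul_assoc cmat_assoc)
    also have "\<dots> = inner z (T *v z)"
      by (subst inner_matrix_vector) (simp add: qD z_def)
    also have "\<dots> = c * (norm z)\<^sup>2 - inner z (Y *v z)"
      by (simp add: T_def matrix_vector_mult_diff_rdistrib cq qz inner_diff_right
          power2_norm_eq_inner)
    also have "\<dots> \<ge> 0"
    proof (cases "z = 0")
      case False
      have "inner ((1 / norm z) *\<^sub>R z) (Y *v ((1 / norm z) *\<^sub>R z)) \<le> c"
        unfolding c_def using normalize[OF qz False] x(2) by blast
      then show ?thesis using False
        by (simp add: matrix_vector_scaleR field_simps power2_eq_square)
    qed simp
    finally show ?thesis .
  qed
  then have psdT: "psd T" by (simp add: psd_def adjT)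
  have x': "q *v x = x" "norm x = 1" using x(1) by (auto simp: S_def)
  have "inner x (T *v x) = 0"
    using x' by (simp add: T_def matrix_vector_mult_diff_rdistrib cq inner_diff_right
        flip: c_def power2_norm_eq_inner)
  then have "T *v x = 0" by (rule psd_kernel[OF psdT])
  then have "Y *v x = csc (of_real c) q *v x"
    by (simp add: T_def matrix_vector_mult_diff_rdistrib)
  moreover have "x \<noteq> 0" using x'(2) by auto
  ultimately show thesis using that x'(1) by blast
qed

text \<open>The kernel of \<open>(Y - c) + (1 - q)\<close> is the eigenspace of \<open>Y\<close> inside the range of \<open>q\<close>.\<close>

lemma schur_hermitian:
  assumes min: "minimal_collecting K hs q" and q: "reduces q K hs"
    and Y: "adj Y = Y" "Y = q ** Y ** q" "K ** Y = Y ** K"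
    and Yh: "\<And>h. h \<in> set hs \<Longrightarrow> h ** Y = Y ** h"
    and Yh': "\<And>h. h \<in> set hs \<Longrightarrow> adj h ** Y = Y ** adj h"
  obtains c where "Y = csc c q"
proof -
  note qD = reducesD[OF q]
  note min = minimal_collectingD[OF min]
  obtain c x where x: "x \<noteq> 0" "q *v x = x" "Y *v x = csc (of_real c) q *v x"
    using hermitian_eigenvector[OF min(1,3) Y(1,2)] .
  define M where "M = Y - csc (of_real c) q + (mat 1 - q)"
  obtain N where N: "orth_proj N" "M ** N = 0" "\<And>x. M *v x = 0 \<Longrightarrow> N *v x = x"
    using kernel_projection by blast
  have qY: "q ** Y = Y" using Y(2) by (metis qD(4) matrix_mul_assoc)
  have Yq: "Y ** q = Y" using Y(2) by (metis qD(4) matrix_mul_assoc)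
  have "q ** (M ** N) = (Y - csc (of_real c) q) ** N"
    unfolding matrix_mul_assoc by (simp add: M_def cmat_expand qD qY)
  then have YN: "(Y - csc (of_real c) q) ** N = 0" using N by simp
  with N(2) have qN: "q ** N = N" by (simp add: M_def cmat_add_rdistrib cmat_diff_rdistrib)
  \<comment> \<open>An operator commuting with \<open>M\<close> preserves its kernel, which makes
    \<open>N\<close> an invariant projection below q. Minimality leaves only q, since
    \<open>x\<close> lies in the kernel.\<close>
  have fixed: "A ** N = N ** A ** N" if "A ** M = M ** A" for A
  proof -
    have "M ** (A ** N) = 0" using that N(2) by (metis cmat_mult_zero(1) matrix_mul_assoc)
    then show ?thesis using matrix_fixed_by_projection[OF N(3)] by (metis matrix_mul_assoc)
  qed
  have hM: "h ** M = M ** h" "adj h ** M = M ** adj h" if "h \<in> set hs" for h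
    using that Yh Yh' by (simp_all add: M_def cmat_expand qD)
  have KM: "K ** M = M ** K"
    using Y(3) by (simp add: M_def cmat_expand qD)
  have "block_invariant K hs N"
    unfolding block_invariant_iff[OF qD(2)]
    using N(1) fixed[OF hM(1)] fixed[OF commute_drift[OF KM hM]] by simp
  then have "N = 0 \<or> N = q" using min(4) qN by blast
  moreover have "M *v x = 0"
    using x by (simp add: M_def matrix_vector_mult_diff_rdistrib matrix_vector_mult_add_rdistrib)
  then have "N \<noteq> 0" using N(3)[of x] x(1) by auto
  ultimately have "Y = csc (of_real c) q"
    using YN Yq by (simp add: cmat_expand qD)
  then show thesis by (rule that)
qed

text \<open>The commutant is closed under adjoints because the hypotheses include the adjoints of
  the h, so the hermitian parts A and B of Y = A + i B each fall under
  \<open>schur_hermitian\<close>.\<close>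

lemma schur:
  assumes min: "minimal_collecting K hs q" and q: "reduces q K hs"
    and Y: "Y = q ** Y ** q" "K ** Y = Y ** K"
    and Yh: "\<And>h. h \<in> set hs \<Longrightarrow> h ** Y = Y ** h"
    and Yh': "\<And>h. h \<in> set hs \<Longrightarrow> adj h ** Y = Y ** adj h"
  obtains c where "Y = csc c q"
proof -
  note qD = reducesD[OF q]
  define A where "A = csc (1/2) (Y + adj Y)"
  define B where "B = csc (- \<i> / 2) (Y - adj Y)"
  have YAB: "Y = A + csc \<i> B"
    by (simp add: A_def B_def vec_eq_iff algebra_simps)
  have Y': "adj Y = q ** adj Y ** q"
    using arg_cong[OF Y(1), of adj] by (simp add: adj_mult qD cmat_assoc)
  have K: "K ** adj Y = adj Y ** K" using commute_adj[OF Y(2)] qD by simp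
  have h: "h ** adj Y = adj Y ** h" "adj h ** adj Y = adj Y ** adj h" if "h \<in> set hs" for h
    using commute_adj[OF Yh[OF that]] commute_adj[OF Yh'[OF that]] by simp_all
  obtain a where a: "A = csc a q"
  proof (rule schur_hermitian[OF min q])
    show "adj A = A" by (simp add: A_def cmat_expand add.commute)
    show "A = q ** A ** q" by (simp add: A_def cmat_expand Y(1)[symmetric] Y'[symmetric])
  qed (auto simp: A_def cmat_expand Y(2) K Yh Yh' h)
  obtain b where b: "B = csc b q"
  proof (rule schur_hermitian[OF min q])
    show "adj B = B" by (simp add: B_def cmat_expand) (simp add: vec_eq_iff)
    show "B = q ** B ** q" by (simp add: B_def cmat_expand Y(1)[symmetric] Y'[symmetric])
  qed (auto simp: B_def cmat_expand Y(2) K Yh Yh' h)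
  have "Y = csc (a + \<i> * b) q"
    using YAB a b by (simp add: vec_eq_iff algebra_simps)
  then show thesis by (rule that)
qed

text \<open>The support of a stationary state is itself collecting. Testing stationarity against the
  projection N onto the kernel of \<open>R\<close> in p shows that the adjoints of the h and of the
  drift preserve that kernel. So Q = p - N is invariant, it is nonzero because \<open>R\<close> is,
  and minimality gives Q = p.\<close>

lemma stationary_faithful:
  fixes p R :: "'n::finite cmat"
  assumes min: "minimal_collecting K hs p" and p: "reduces p K hs"
    and R: "psd R" "R = p ** R ** p" "lindblad K hs R = 0" "R \<noteq> 0"
  shows "faithful_on p R"
proof -
  note pD = reducesD[OF p]
  note min = minimal_collectingD[OF min]
  define G where "G = drift K hs"
  have adjR: "adj R = R" using R by (simp add: psd_def)
  have pR: "p ** R = R" using R(2) by (metis pD(4) matrix_mul_assoc)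
  have Rp: "R ** p = R" using R(2) by (metis pD(4) matrix_mul_assoc)
  define M where "M = R + (mat 1 - p)"
  obtain N where N: "orth_proj N" "M ** N = 0" "\<And>x. M *v x = 0 \<Longrightarrow> N *v x = x"
    using kernel_projection by blast
  note ND = orth_projD[OF N(1)]
  have "p ** (M ** N) = R ** N"
    unfolding matrix_mul_assoc by (simp add: M_def cmat_expand pD pR)
  then have RN: "R ** N = 0" using N by simp
  with N(2) have pN: "p ** N = N" by (simp add: M_def cmat_add_rdistrib cmat_diff_rdistrib)
  have NR: "N ** R = 0" using arg_cong[OF RN, of adj] by (simp add: adj_mult ND adjR)
  have NRA: "inner N (A ** R) = 0" "inner N (R ** A) = 0" for A
    using inner_mult_right[of N R A] inner_mult_left[of R N A] by (simp_all add: adjR NR RN)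
  have D: "lindblad K hs R = G ** R + R ** adj G + (\<Sum>h\<leftarrow>hs. h ** R ** adj h)"
    unfolding G_def by (rule lindblad_drift[OF pD(2)])
  have move: "inner N (h ** R ** adj h) = inner R ((adj h ** N) ** adj (adj h ** N))" for h
  proof -
    have "inner (h ** R ** adj h) N = inner R (adj h ** (N ** h))"
      by (simp add: inner_mult_right[of _ "adj h"] inner_mult_left[of h] cmat_assoc)
    then show ?thesis
      by (simp add: inner_commute[of N] adj_mult ND cmat_assoc)
  qed
  have "inner N (lindblad K hs R) = 0" using R by simp
  then have "(\<Sum>h\<leftarrow>hs. inner R ((adj h ** N) ** adj (adj h ** N))) = 0"
    by (simp only: D inner_add_right NRA inner_sum_list move)
  then have "\<forall>h\<in>set hs. inner R ((adj h ** N) ** adj (adj h ** N)) = 0"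
    using inner_psd_nonneg[OF R(1)] by (subst (asm) sum_list_nonneg_eq_0_iff) auto
  then have RhN: "R ** (adj h ** N) = 0" if "h \<in> set hs" for h
    using psd_kernel_matrix[OF R(1)] that by blast
  have "(\<Sum>h\<leftarrow>hs. h ** R ** adj h) ** N = 0"
    using RhN by (induction hs) (auto simp: cmat_assoc cmat_add_rdistrib)
  then have RGN: "R ** (adj G ** N) = 0"
    using arg_cong[OF R(3), of "\<lambda>A. A ** N"]
    by (simp add: D cmat_add_rdistrib cmat_assoc RN)
  \<comment> \<open>If adj A maps the kernel of \<open>R\<close> in p to itself, then taking
    adjoints shows that A maps the complement Q to itself.\<close>
  have fixed: "N ** A ** N = N ** A" if "R ** (adj A ** N) = 0" "adj A ** p = p ** adj A" for A
  proof -
    have "M ** (adj A ** N) = adj A ** N - p ** (adj A ** N)"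
      using that(1) by (simp add: M_def cmat_add_rdistrib cmat_diff_rdistrib)
    also have "p ** (adj A ** N) = adj A ** N"
      using that(2) pN by (metis matrix_mul_assoc)
    finally have "M ** (adj A ** N) = 0" by simp
    then have "N ** (adj A ** N) = adj A ** N" using matrix_fixed_by_projection[of M N, OF N(3)] by blast
    from arg_cong[OF this, of adj] show ?thesis by (simp add: adj_mult ND cmat_assoc)
  qed
  define Q where "Q = p - N"
  have Np: "N ** p = N" and Q: "orth_proj Q"
    using orth_proj_diff[OF pD(1) N(1) pN] by (auto simp: Q_def)
  have inv: "A ** Q = Q ** A ** Q" if A: "N ** A ** N = N ** A" "A ** p = p ** A" for A
  proof -
    have "p ** A ** p = A ** p" using A(2) by (metis pD(4) matrix_mul_assoc)
    moreover have "p ** A ** N = A ** N" using A(2) pN by (metis matrix_mul_assoc)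
    moreover have "N ** A ** p = N ** A" using A(2) Np by (metis matrix_mul_assoc)
    ultimately show ?thesis using A(1) by (simp add: Q_def cmat_diff_ldistrib cmat_diff_rdistrib)
  qed
  have "block_invariant K hs Q"
    unfolding block_invariant_iff[OF pD(2)]
  proof (intro conjI ballI)
    fix h assume "h \<in> set hs"
    then show "h ** Q = Q ** h ** Q"
      by (intro inv fixed RhN) (auto simp: pD)
  next
    show "drift K hs ** Q = Q ** drift K hs ** Q"
      using RGN reduces_drift[OF p] by (intro inv fixed) (auto simp: G_def)
  qed (rule Q)
  moreover have "p ** Q = Q" by (simp add: Q_def cmat_expand pD pN)
  ultimately have "Q = 0 \<or> Q = p" using min(4) by blast
  moreover have "Q \<noteq> 0"
  proof
    assume "Q = 0"
    then have "N = p" by (simp add: Q_def)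
    with RN Rp R(4) show False by simp
  qed
  ultimately have "N = 0" by (simp add: Q_def)
  show ?thesis
    unfolding faithful_on_def
  proof (intro conjI allI impI R(1))
    fix W :: "'n cmat"
    assume "p ** W = W \<and> R ** W = 0"
    then have "M ** W = 0" by (simp add: M_def cmat_add_rdistrib cmat_diff_rdistrib)
    then have "N ** W = W" using matrix_fixed_by_projection[of M N, OF N(3)] by blast
    then show "W = 0" using \<open>N = 0\<close> by simp
  qed
qed

subsection \<open>Intertwiners between basins\<close>

text \<open>Existence of a stationary state is built in, to have a faithful weight for the
  dissipation identity. Its uniqueness is derived in \<open>stationary_unique\<close>.\<close>

definition basin :: "'n::finite cmat \<Rightarrow> 'n cmat list \<Rightarrow> 'n cmat \<Rightarrow> bool" where
  "basin K hs p \<longleftrightarrow> minimal_collecting K hs p \<and> reduces p K hs \<and>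
     (\<exists>R. density R \<and> lindblad K hs R = 0 \<and> R = p ** R ** p)"

text \<open>V is a partial isometry from the range of q onto that of p. The sign of \<omega> is
  chosen so that right multiplication by V shifts eigenvalues of the generator by +i \<omega>, see
  \<open>lindblad_intertwiner\<close>.\<close>

definition intertwiner ::
  "'n::finite cmat \<Rightarrow> 'n cmat list \<Rightarrow> 'n cmat \<Rightarrow> 'n cmat \<Rightarrow> real \<Rightarrow> 'n cmat \<Rightarrow> bool" where
  "intertwiner K hs p q \<omega> V \<longleftrightarrow> V = p ** V ** q \<and> adj V ** V = q \<and> V ** adj V = p \<and>
     (\<forall>h\<in>set hs. h ** V = V ** h \<and> adj h ** V = V ** adj h) \<and>
     K ** V - V ** K = csc (of_real (- \<omega>)) V"

lemma density_faithful:
  assumes "basin K hs p" "density R" "lindblad K hs R = 0" "R = p ** R ** p"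
  shows "faithful_on p R"
proof -
  have "R \<noteq> 0" using assms(2) by (auto simp: density_iff trace_def)
  then show ?thesis
    using assms by (intro stationary_faithful) (auto simp: basin_def density_iff)
qed

lemma intertwiner_adj:
  assumes "adj K = K" "adj p = p" "adj q = q" "intertwiner K hs p q \<omega> V"
  shows "intertwiner K hs q p (- \<omega>) (adj V)"
proof -
  have V: "V = p ** V ** q" "adj V ** V = q" "V ** adj V = p"
    "\<And>h. h \<in> set hs \<Longrightarrow> h ** V = V ** h" "\<And>h. h \<in> set hs \<Longrightarrow> adj h ** V = V ** adj h"
    "K ** V - V ** K = csc (of_real (- \<omega>)) V"
    using assms(4) unfolding intertwiner_def by blast+
  have "adj V = q ** adj V ** p"
    using arg_cong[OF V(1), of adj] by (simp add: adj_mult assms cmat_assoc)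
  moreover have "h ** adj V = adj V ** h" "adj h ** adj V = adj V ** adj h" if "h \<in> set hs" for h
    using commute_adj[OF V(4)[OF that]] commute_adj[OF V(5)[OF that]] by simp_all
  moreover have "adj V ** K - K ** adj V = csc (of_real (- \<omega>)) (adj V)"
    using arg_cong[OF V(6), of adj] by (simp add: cmat_expand assms)
  then have "K ** adj V - adj V ** K = csc (of_real \<omega>) (adj V)"
    by (simp add: vec_eq_iff algebra_simps)
  ultimately show ?thesis using V by (simp add: intertwiner_def)
qed

lemma intertwiner_mult:
  assumes "intertwiner K hs p q \<omega> V" "intertwiner K hs q r \<omega>' W" "p ** p = p" "r ** r = r" "q ** q = q"
  shows "intertwiner K hs p r (\<omega> + \<omega>') (V ** W)"
proof -
  have V: "V = p ** V ** q" "adj V ** V = q" "V ** adj V = p"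
    "\<And>h. h \<in> set hs \<Longrightarrow> h ** V = V ** h" "\<And>h. h \<in> set hs \<Longrightarrow> adj h ** V = V ** adj h"
    "K ** V - V ** K = csc (of_real (- \<omega>)) V"
    using assms(1) unfolding intertwiner_def by blast+
  have W: "W = q ** W ** r" "adj W ** W = r" "W ** adj W = q"
    "\<And>h. h \<in> set hs \<Longrightarrow> h ** W = W ** h" "\<And>h. h \<in> set hs \<Longrightarrow> adj h ** W = W ** adj h"
    "K ** W - W ** K = csc (of_real (- \<omega>')) W"
    using assms(2) unfolding intertwiner_def by blast+
  have qW: "q ** W = W" and Vq: "V ** q = V"
    using V(1) W(1) assms(5) by (metis matrix_mul_assoc)+
  have "p ** V = V" "W ** r = W"
    using V(1) W(1) assms(3,4) by (metis matrix_mul_assoc)+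
  then have 1: "V ** W = p ** (V ** W) ** r" by (simp add: matrix_mul_assoc) (simp add: cmat_assoc)
  have "adj W ** (adj V ** V) ** W = r"
    unfolding V(2) using qW by (simp add: cmat_assoc W(2))
  then have 2: "adj (V ** W) ** (V ** W) = r" by (simp add: adj_mult cmat_assoc)
  have "V ** (W ** adj W) ** adj V = p"
    unfolding W(3) Vq by (rule V(3))
  then have 3: "(V ** W) ** adj (V ** W) = p" by (simp add: adj_mult cmat_assoc)
  have "K ** (V ** W) - (V ** W) ** K = (K ** V - V ** K) ** W + V ** (K ** W - W ** K)"
    by (simp add: cmat_expand cmat_assoc)
  also have "\<dots> = csc (of_real (- (\<omega> + \<omega>'))) (V ** W)"
    unfolding V(6) W(6) by (simp add: cmat_expand) (simp add: vec_eq_iff algebra_simps)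
  finally have 4: "K ** (V ** W) - (V ** W) ** K = csc (of_real (- (\<omega> + \<omega>'))) (V ** W)" .
  have "h ** (V ** W) = (V ** W) ** h" "adj h ** (V ** W) = (V ** W) ** adj h" if "h \<in> set hs" for h
    using V(4,5)[OF that] W(4,5)[OF that] by (simp_all add: matrix_mul_assoc) (simp_all add: cmat_assoc)
  then show ?thesis
    using 1 2 3 4 unfolding intertwiner_def by blast
qed

text \<open>By cyclicity of the trace, K V - V K has trace 0 against adj V. That trace also equals
  -\<omega> times the trace of p, which is nonzero.\<close>

lemma self_intertwiner_frequency:
  assumes "orth_proj p" "p \<noteq> 0" "intertwiner K hs p p \<omega> V"
  shows "\<omega> = 0"
proof -
  have V: "V = p ** V ** p" "adj V ** V = p" "V ** adj V = p"
    "K ** V - V ** K = csc (of_real (- \<omega>)) V"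
    using assms(3) unfolding intertwiner_def by blast+
  have "trace (V ** (K ** adj V)) = trace ((K ** adj V) ** V)" by (rule trace_mul_sym)
  then have "trace ((K ** V - V ** K) ** adj V) = 0"
    using V(2,3) by (simp add: cmat_expand cmat_assoc trace_sub)
  then have "of_real (- \<omega>) * trace p = 0"
    unfolding V(4) by (simp add: csc_mult_left V(3) trace_csc)
  moreover have "trace p \<noteq> 0"
    using psd_trace_0[OF orth_proj_psd[OF assms(1)]] assms(2) by auto
  ultimately show ?thesis by simp
qed

text \<open>V ** adj W intertwines p with itself, and its frequency is the difference of the
  two.\<close>

lemma intertwiner_frequency_unique:
  assumes p: "reduces p K hs" "p \<noteq> 0" and q: "reduces q K hs"
    and V: "intertwiner K hs p q \<omega> V" and W: "intertwiner K hs p q \<omega>' W"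
  shows "\<omega>' = \<omega>"
proof -
  note pD = reducesD[OF p(1)] and qD = reducesD[OF q]
  have "intertwiner K hs p p (\<omega> + - \<omega>') (V ** adj W)"
    by (rule intertwiner_mult[OF V intertwiner_adj[OF pD(2,3) qD(3) W] pD(4,4) qD(4)])
  then show ?thesis using self_intertwiner_frequency[OF pD(1) p(2)] by force
qed

section \<open>Eigenvalues and eigenspaces of a block that has an intertwiner\<close>

lemma lindblad_intertwiner:
  assumes "intertwiner K hs p q \<omega> V"
  shows "lindblad K hs (s ** V) = lindblad K hs s ** V + csc (\<i> * of_real \<omega>) (s ** V)"
proof -
  have V: "\<And>h. h \<in> set hs \<Longrightarrow> h ** V = V ** h" "\<And>h. h \<in> set hs \<Longrightarrow> adj h ** V = V ** adj h"
    "K ** V - V ** K = csc (of_real (- \<omega>)) V"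
    using assms unfolding intertwiner_def by blast+
  have VK: "V ** K = K ** V + csc (of_real \<omega>) V"
    using V(3) by (simp add: vec_eq_iff algebra_simps)
  have "lindblad K hs' (s ** V) = lindblad K hs' s ** V + csc (\<i> * of_real \<omega>) (s ** V)"
    if "set hs' \<subseteq> set hs" for hs'
    using that
  proof (induction hs')
    case Nil
    show ?case
      by (simp add: lindblad_Nil cmat_expand cmat_assoc VK) (simp add: vec_eq_iff algebra_simps)
  next
    case (Cons h hs')
    then have h: "V ** h = h ** V" "V ** adj h = adj h ** V" using V by auto
    have "V ** (adj h ** h) = adj h ** (h ** V)" using h by (metis matrix_mul_assoc)
    then show ?case
      using Cons h by (simp add: lindblad_Cons cmat_expand cmat_assoc)
  qed
  then show ?thesis by simp
qed

lemma eigenvalue_intertwiner: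
  assumes p: "basin K hs p" and q: "basin K hs q"
    and s: "s = p ** s ** q" "s \<noteq> 0" "lindblad K hs s = csc lam s" "Re lam \<ge> 0"
  obtains \<omega> V where "lam = \<i> * of_real \<omega>" "intertwiner K hs p q \<omega> V"
proof -
  have rp: "reduces p K hs" and rq: "reduces q K hs"
    and mp: "minimal_collecting K hs p" and mq: "minimal_collecting K hs q"
    using p q by (auto simp: basin_def)
  note pD = reducesD[OF rp] and qD = reducesD[OF rq]
  obtain Rp Rq where "density Rp" "lindblad K hs Rp = 0" "Rp = p ** Rp ** p"
    "density Rq" "lindblad K hs Rq = 0" "Rq = q ** Rq ** q"
    using p q by (auto simp: basin_def)
  then have Rp: "faithful_on p Rp" "lindblad K hs Rp = 0"
    and Rq: "faithful_on q Rq" "lindblad K hs Rq = 0"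
    using density_faithful p q by blast+
  obtain X where X: "X = p ** X ** q" "X \<noteq> 0" "lindblad_dual K hs X = csc (cnj lam) X"
    using dual_eigenvector[OF rp rq s(1-3)] .
  have "Re (cnj lam) \<ge> 0" using s by simp
  note C = dual_eigenvector_commutes[OF rp rq Rp Rq X this]
  define \<omega> where "\<omega> = Im lam"
  have lam: "lam = \<i> * of_real \<omega>" using C(1) by (simp add: \<omega>_def complex_eq_iff)
  have KX: "K ** X - X ** K = csc (of_real (- \<omega>)) X"
    using C(4) unfolding lam by simp
  have hX: "h ** adj X = adj X ** h" "adj h ** adj X = adj X ** adj h" if "h \<in> set hs" for h
    using commute_adj[OF C(2)[OF that]] commute_adj[OF C(3)[OF that]] by simp_all
  have KX': "adj X ** K - K ** adj X = csc (of_real (- \<omega>)) (adj X)"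
    using arg_cong[OF KX, of adj] by (simp add: cmat_expand pD)
  have pX: "p ** X = X" "X ** q = X" using X(1) pD(4) qD(4) by (metis matrix_mul_assoc)+
  have X'q: "adj X ** p = adj X" "q ** adj X = adj X"
    using arg_cong[OF pX(1), of adj] arg_cong[OF pX(2), of adj] by (simp_all add: adj_mult pD qD)
  obtain c where c: "adj X ** X = csc c q"
  proof (rule schur[OF mq rq, of "adj X ** X"])
    show "adj X ** X = q ** (adj X ** X) ** q" by (simp add: matrix_mul_assoc X'q) (simp add: cmat_assoc pX)
    have "K ** (adj X ** X) - adj X ** X ** K =
        adj X ** (K ** X - X ** K) - (adj X ** K - K ** adj X) ** X"
      by (simp add: cmat_expand cmat_assoc)
    then show "K ** (adj X ** X) = adj X ** X ** K"
      unfolding KX KX' by (simp add: cmat_expand)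
  qed (simp add: matrix_mul_assoc hX, simp add: cmat_assoc C(2,3))+
  obtain d where d: "X ** adj X = csc d p"
  proof (rule schur[OF mp rp, of "X ** adj X"])
    show "X ** adj X = p ** (X ** adj X) ** p" by (simp add: matrix_mul_assoc pX) (simp add: cmat_assoc X'q)
    have "K ** (X ** adj X) - X ** adj X ** K =
        (K ** X - X ** K) ** adj X - X ** (adj X ** K - K ** adj X)"
      by (simp add: cmat_expand cmat_assoc)
    then show "K ** (X ** adj X) = X ** adj X ** K"
      unfolding KX KX' by (simp add: cmat_expand)
  qed (simp add: matrix_mul_assoc C(2,3), simp add: cmat_assoc hX)+
  \<comment> \<open>The two Schur constants agree because X ** adj X ** X can be bracketed in two
    ways.\<close>
  have "csc d X = csc c X"
  proof -
    have "csc d X = (X ** adj X) ** X" unfolding d by (simp add: csc_mult_left pX)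
    also have "\<dots> = X ** (adj X ** X)" by (simp add: matrix_mul_assoc)
    also have "\<dots> = csc c X" unfolding c by (simp add: csc_mult_right pX)
    finally show ?thesis .
  qed
  then have "csc (d - c) X = 0" by (simp add: vec_eq_iff algebra_simps)
  then have dc: "d = c" using X(2) by (simp add: csc_eq_0_iff)
  have XX: "adj X ** X \<noteq> 0"
  proof
    assume "adj X ** X = 0"
    then have "inner X X = 0" by (simp add: inner_cmat trace_def)
    then show False using X(2) by simp
  qed
  have psdX: "psd (adj X ** X)" by (rule psd_adj_mult)
  define r where "r = Re (trace (adj X ** X))"
  define t where "t = Re (trace q)"
  have r: "r > 0" unfolding r_def
    using psd_trace_nonneg[OF psdX] psd_trace_0[OF psdX] XX by (metis less_eq_real_def)
  have tr_r: "trace (adj X ** X) = of_real r" unfolding r_def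
    using psdX by (intro trace_hermitian_real) (simp add: psd_def)
  have q0: "q \<noteq> 0" using minimal_collectingD[OF mq] by simp
  have psdq: "psd q" by (rule orth_proj_psd[OF qD(1)])
  have t: "t > 0" unfolding t_def
    using psd_trace_nonneg[OF psdq] psd_trace_0[OF psdq] q0 by (metis less_eq_real_def)
  have tr_t: "trace q = of_real t" unfolding t_def
    using qD by (intro trace_hermitian_real)
  \<comment> \<open>Traces show that the Schur constant is real and positive, so dividing X by its
    square root gives the partial isometry V.\<close>
  have "c * trace q = trace (adj X ** X)" by (simp add: c trace_csc)
  then have cr: "c = of_real (r / t)" using t by (simp add: tr_r tr_t field_simps)
  have "r / t > 0" using r t by simp
  define V where "V = csc (of_real (1 / sqrt (r / t))) X"
  have "of_real (1 / sqrt (r / t)) * of_real (1 / sqrt (r / t)) * c = 1"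
  proof -
    have "1 / sqrt (r / t) * (1 / sqrt (r / t)) * (r / t) = 1"
      using r t by simp
    then show ?thesis unfolding cr of_real_mult[symmetric] by simp
  qed
  then have VV: "adj V ** V = q" "V ** adj V = p"
    by (simp_all add: V_def cmat_expand c d dc)
  have "intertwiner K hs p q \<omega> V"
    unfolding intertwiner_def
  proof (intro conjI ballI VV)
    show "V = p ** V ** q" using X(1)[symmetric] by (simp add: V_def cmat_expand)
    show "K ** V - V ** K = csc (of_real (- \<omega>)) V"
      unfolding V_def csc_mult_left csc_mult_right csc_diff[symmetric] KX
      by (simp add: mult.commute)
  qed (simp_all add: V_def cmat_expand C)
  with lam show thesis by (rule that)
qed

text \<open>The rank-one term makes the generator injective, because its adjoint is: the dual
  generator only annihilates multiples of \<open>p\<close>, and these are detected by \<open>R\<close>.\<close>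

lemma stationary_unique:
  assumes p: "basin K hs p"
    and R: "density R" "lindblad K hs R = 0" "R = p ** R ** p"
    and T: "T = p ** T ** p" "lindblad K hs T = 0"
  obtains c where "T = csc c R"
proof -
  have rp: "reduces p K hs" and mp: "minimal_collecting K hs p"
    using p by (auto simp: basin_def)
  note pD = reducesD[OF rp]
  have Rf: "faithful_on p R" by (rule density_faithful[OF p R])
  have adjR: "adj R = R" and trR: "trace R = 1" using R(1) by (auto simp: density_iff psd_def)
  have Rp: "R ** p = R" using R(3) pD(4) by (metis matrix_mul_assoc)
  \<comment> \<open>As in \<open>dual_eigenvector\<close>, the terms s - p s p act as the identity
    off the corner, so the adjoint argument can run on all matrices.\<close>
  define f where "f s = lindblad K hs (p ** s ** p) + s - p ** s ** p + csc (trace (p ** s ** p)) R" for s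
  define g where "g X = lindblad_dual K hs (p ** X ** p) + X - p ** X ** p + csc (trace (R ** X)) p" for X
  have lin_tr: "linear (\<lambda>X. csc (trace (R ** X)) p)"
    by (rule linearI) (simp_all add: matrix_add_ldistrib scaleR_csc csc_mult_right trace_csc trace_add,
      simp add: vec_eq_iff algebra_simps)
  have "linear g" unfolding g_def
    by (intro linear_compose_sub linear_compose_add linear_ident linear_block lin_tr
        linear_compose[OF linear_block linear_lindblad_dual, unfolded o_def])
  moreover have "inner (f x) y = inner x (g y)" for x y
  proof -
    have "inner (lindblad K hs (p ** x ** p)) y = inner x (lindblad_dual K hs (p ** y ** p))"
      unfolding inner_lindblad[OF pD(2)] reduces_lindblad_dual[OF rp rp]
      by (simp add: inner_block pD)
    moreover have "inner (csc (trace (p ** x ** p)) R) y = inner x (csc (trace (R ** y)) p)"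
    proof -
      have "inner (csc (trace (p ** x ** p)) R) y = Re (cnj (trace (p ** x ** p)) * trace (R ** y))"
        by (simp add: inner_cmat adj_csc csc_mult_left trace_csc adjR)
      also have "\<dots> = inner (p ** x ** p) (csc (trace (R ** y)) (mat 1))"
        by (simp add: inner_cmat csc_mult_right trace_csc trace_adj mult.commute)
      also have "\<dots> = inner x (csc (trace (R ** y)) p)"
        by (simp add: inner_block pD csc_mult_left csc_mult_right)
      finally show ?thesis .
    qed
    ultimately show ?thesis
      by (simp add: f_def g_def inner_block pD inner_add_left inner_diff_left
          inner_add_right inner_diff_right)
  qed
  moreover have "X = 0" if gX: "g X = 0" for X
  proof -
    define t where "t = trace (R ** X)"
    have pp: "p ** (p ** A ** p) ** p = p ** A ** p" for A
      by (simp add: cmat_assoc pD)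
    have "p ** g X ** p = lindblad_dual K hs (p ** X ** p) + csc t p"
      unfolding g_def reduces_lindblad_dual[OF rp rp] cmat_expand pp by (simp add: pD t_def)
    then have 1: "lindblad_dual K hs (p ** X ** p) = - csc t p"
      using gX by (simp add: eq_neg_iff_add_eq_0)
    then have X: "X = p ** X ** p" using gX by (simp add: g_def t_def)
    then have dX: "lindblad_dual K hs X = csc (- t) p"
      using 1 X by (metis csc_minus)
    \<comment> \<open>The real inner product yields only a real part; letting a be 1 and then i
      recovers the complex number t.\<close>
    have "inner R (csc a (lindblad_dual K hs X)) = 0" for a
      using inner_lindblad[OF pD(2), of hs R "csc a X"] R(2) by (simp add: lindblad_dual_csc)
    then have "inner R (csc (a * - t) p) = 0" for a
      unfolding dX by simp
    then have "Re (a * - t) = 0" for a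
      by (simp only: inner_cmat adjR csc_mult_right Rp trace_csc trR mult_1_right)
    from this[of 1] this[of "\<i>"] have t: "t = 0" by (simp add: complex_eq_iff)
    show "X = 0"
    proof (rule ccontr)
      assume ne: "X \<noteq> 0"
      have "lindblad_dual K hs X = csc 0 X" using dX t by simp
      note C = dual_eigenvector_commutes[OF rp rp Rf R(2) Rf R(2) X ne this]
      obtain c where "X = csc c p"
        by (rule schur[OF mp rp X]) (use C in auto)
      then show False using t ne by (simp add: t_def csc_mult_right Rp trace_csc trR)
    qed
  qed
  ultimately have inj: "x = 0" if "f x = 0" for x
    using injective_if_adjoint_injective[of g f x] that by blast
  \<comment> \<open>Subtracting this multiple of \<open>R\<close> leaves a stationary matrix of
    trace 0, on which the rank-one term vanishes too.\<close>
  have "f (T - csc (trace T) R) = 0"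
  proof -
    have "lindblad K hs (T - csc (trace T) R) = 0"
      using linear_diff[OF linear_lindblad, of K hs T "csc (trace T) R"] T(2) R(2)
      by (simp add: lindblad_csc)
    moreover have "p ** (T - csc (trace T) R) ** p = T - csc (trace T) R"
      using T(1)[symmetric] R(3)[symmetric] by (simp add: cmat_expand)
    ultimately show ?thesis by (simp add: f_def trace_sub trace_csc trR)
  qed
  then show thesis using inj that by (metis right_minus_eq)
qed

lemma intertwiner_eigenspace:
  assumes p: "basin K hs p" and q: "basin K hs q" and I: "intertwiner K hs p q \<omega> V"
    and R: "density R" "lindblad K hs R = 0" "R = p ** R ** p"
  shows "eigspace_on (lindblad K hs) (block p q) (\<i> * of_real \<omega>) = {csc c (R ** V) |c. True}"
proof -
  have rp: "reduces p K hs" and rq: "reduces q K hs"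
    using p q by (auto simp: basin_def)
  note pD = reducesD[OF rp] and qD = reducesD[OF rq]
  have V: "V = p ** V ** q" "adj V ** V = q" "V ** adj V = p"
    using I unfolding intertwiner_def by blast+
  have pR: "p ** R = R" using R(3) pD(4) by (metis matrix_mul_assoc)
  have Vq: "V ** q = V" "p ** V = V" using V(1) pD(4) qD(4) by (metis matrix_mul_assoc)+
  have V'p: "adj V ** p = adj V" using arg_cong[OF Vq(2), of adj] by (simp add: adj_mult pD)
  have I': "intertwiner K hs q p (- \<omega>) (adj V)" using I pD qD by (intro intertwiner_adj)
  show ?thesis
  proof (intro equalityI subsetI)
    fix s assume "s \<in> eigspace_on (lindblad K hs) (block p q) (\<i> * of_real \<omega>)"
    then have s: "s = p ** s ** q" "lindblad K hs s = csc (\<i> * of_real \<omega>) s"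
      by (auto simp: eigspace_on_def block_def)
    have sq: "s ** q = s" "p ** s = s" using s(1) pD(4) qD(4) by (metis matrix_mul_assoc)+
    have "s ** adj V = p ** (s ** adj V) ** p"
      by (simp add: matrix_mul_assoc sq) (simp add: cmat_assoc V'p)
    moreover have "lindblad K hs (s ** adj V) = 0"
      unfolding lindblad_intertwiner[OF I'] s(2) by (simp add: csc_mult_left) (simp add: vec_eq_iff)
    ultimately obtain c where "s ** adj V = csc c R"
      using stationary_unique[OF p R] by blast
    then have "s ** (adj V ** V) = csc c (R ** V)"
      by (simp add: matrix_mul_assoc csc_mult_left)
    then show "s \<in> {csc c (R ** V) |c. True}" using V(2) sq by auto
  next
    fix s assume "s \<in> {csc c (R ** V) |c. True}"
    then obtain c where s: "s = csc c (R ** V)" by auto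
    have "p ** (R ** V) ** q = R ** V"
      by (simp add: matrix_mul_assoc pR) (simp add: cmat_assoc Vq)
    then have "s = p ** s ** q" by (simp add: s cmat_expand)
    moreover have "lindblad K hs s = csc (\<i> * of_real \<omega>) s"
      unfolding s lindblad_csc lindblad_intertwiner[OF I] R(2) by (simp add: mult.commute)
    ultimately show "s \<in> eigspace_on (lindblad K hs) (block p q) (\<i> * of_real \<omega>)"
      by (simp add: eigspace_on_def block_def)
  qed
qed

lemma intertwiner_eigenvalues:
  assumes p: "basin K hs p" and q: "basin K hs q" and I: "intertwiner K hs p q \<omega> V"
    and "eigval_on (lindblad K hs) (block p q) lam" "lam \<noteq> \<i> * of_real \<omega>"
  shows "Re lam < 0"
proof (rule ccontr)
  assume "\<not> Re lam < 0"
  then have "Re lam \<ge> 0" by simp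
  moreover obtain s where "s = p ** s ** q" "s \<noteq> 0" "lindblad K hs s = csc lam s"
    using assms(4) by (auto simp: eigval_on_def block_def)
  ultimately obtain \<omega>' W where "lam = \<i> * of_real \<omega>'" "intertwiner K hs p q \<omega>' W"
    using eigenvalue_intertwiner[OF p q] by blast
  moreover have "p \<noteq> 0" "reduces p K hs" "reduces q K hs"
    using p q minimal_collectingD(3) by (auto simp: basin_def)
  ultimately show False using intertwiner_frequency_unique[OF _ _ _ I] assms(5) by blast
qed

text \<open>Restricting U to the range of q gives the partial isometry. Commutation with the
  adjoints of the h is not among the assumptions on U; it comes from unitarity and from p and q
  reducing the h.\<close>

lemma unitary_intertwiner:
  assumes p: "reduces p K hs" and q: "reduces q K hs" and U: "unitary_on P0 U"
    and sub: "p ** P0 = p" "q ** P0 = q"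
    and Uq: "U ** q = p ** U" and Uh: "\<And>h. h \<in> set hs \<Longrightarrow> U ** h = h ** U"
    and UK: "K ** (U ** q) - (U ** q) ** K = csc (of_real (- \<omega>)) (U ** q)"
  shows "intertwiner K hs p q \<omega> (U ** q)"
proof -
  note pD = reducesD[OF p] and qD = reducesD[OF q]
  have UU: "adj U ** U = P0" "U ** adj U = P0" using U by (auto simp: unitary_on_def)
  define V where "V = U ** q"
  have "q ** (adj U ** U) ** q = q" unfolding UU using sub qD by simp
  then have VV: "adj V ** V = q" by (simp add: V_def adj_mult qD cmat_assoc)
  have "V ** adj V = U ** (q ** q) ** adj U"
    by (simp add: V_def adj_mult qD(3) cmat_assoc)
  also have "\<dots> = (p ** U) ** adj U" by (simp add: qD(4) Uq)
  finally have "V ** adj V = (p ** U) ** adj U" .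
  then have VV': "V ** adj V = p" by (simp add: cmat_assoc UU sub)
  have pV: "p ** V = V" "V ** q = V"
    using Uq by (simp_all add: V_def pD(5)) (metis Uq qD(4) cmat_assoc)
  have Vp: "adj V ** p = adj V" "q ** adj V = adj V"
    using arg_cong[OF pV(1), of adj] arg_cong[OF pV(2), of adj] by (simp_all add: adj_mult pD qD)
  have hV: "h ** V = V ** h" if "h \<in> set hs" for h
    unfolding V_def using Uh[OF that] qD(8)[OF that] by (metis matrix_mul_assoc)
  have "adj h ** V = V ** adj h" if "h \<in> set hs" for h
  proof -
    \<comment> \<open>Sandwiching h V = V h between copies of adj V cancels V on either side and
      gives adj V ** h = h ** adj V, whose adjoint is the claim.\<close>
    have "adj V ** (h ** V) ** adj V = adj V ** (V ** h) ** adj V" using hV that by simp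
    then have "(adj V ** h) ** (V ** adj V) = (adj V ** V) ** (h ** adj V)"
      by (simp add: matrix_mul_assoc)
    then have "adj V ** (h ** p) = (q ** h) ** adj V"
      unfolding VV VV' by (simp add: cmat_assoc)
    then have "(adj V ** p) ** h = h ** (q ** adj V)"
      using pD(8)[OF that] qD(8)[OF that] by (simp add: matrix_mul_assoc)
    then have "adj V ** h = h ** adj V" using Vp by simp
    then show ?thesis using commute_adj[of "adj V" h] by simp
  qed
  moreover have "V = p ** V ** q" using pV by simp
  ultimately show ?thesis using hV VV VV' UK by (simp add: intertwiner_def V_def)
qed

subsection \<open>Compression to the recurrent subspace\<close>

text \<open>Compression is not multiplicative in general. Here adj h ** h survives it because h maps
  the range of \<open>P0\<close> into itself, so no term passes through the complement.\<close>

lemma compressed_drift: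
  assumes P0: "orth_proj P0" and h: "\<And>h. h \<in> set hs \<Longrightarrow> h ** P0 = P0 ** h ** P0"
  shows "drift (P0 ** H ** P0) (map (\<lambda>h. P0 ** h ** P0) hs) = P0 ** drift H hs ** P0"
proof -
  note D = orth_projD[OF P0]
  have "adj (P0 ** h ** P0) ** (P0 ** h ** P0) = P0 ** (adj h ** h) ** P0" if "h \<in> set hs" for h
  proof -
    have "adj (P0 ** h ** P0) ** (P0 ** h ** P0) = adj (h ** P0) ** (h ** P0)"
      using h[OF that] by simp
    then show ?thesis by (simp add: adj_mult D cmat_assoc)
  qed
  then have "(\<Sum>h\<leftarrow>hs. adj (P0 ** h ** P0) ** (P0 ** h ** P0)) = (\<Sum>h\<leftarrow>hs. P0 ** (adj h ** h) ** P0)"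
    by (intro arg_cong[where f = sum_list] map_cong refl)
  then show ?thesis
    by (simp add: drift_def o_def cmat_diff_ldistrib cmat_diff_rdistrib csc_mult_left csc_mult_right
        sum_list_mult_left sum_list_mult_right)
qed

lemma compressed_lindblad:
  assumes H: "adj H = H" and P0: "orth_proj P0" and h: "\<And>h. h \<in> set hs \<Longrightarrow> h ** P0 = P0 ** h ** P0"
    and g: "drift H hs ** P0 = P0 ** drift H hs ** P0" and s: "s = P0 ** s ** P0"
  shows "lindblad (P0 ** H ** P0) (map (\<lambda>h. P0 ** h ** P0) hs) s = lindblad H hs s"
proof -
  note D = orth_projD[OF P0]
  have K: "adj (P0 ** H ** P0) = P0 ** H ** P0" by (simp add: adj_mult D H cmat_assoc)
  have sP: "P0 ** s = s" "s ** P0 = s" using s D(2) by (metis matrix_mul_assoc)+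
  then have sP': "P0 ** (s ** A) = s ** A" "s ** (P0 ** A) = s ** A" for A
    by (metis matrix_mul_assoc)+
  have drift: "drift (P0 ** H ** P0) (map (\<lambda>h. P0 ** h ** P0) hs) = P0 ** drift H hs ** P0"
    using h by (rule compressed_drift[OF P0])
  have 1: "P0 ** drift H hs ** P0 ** s = drift H hs ** s"
    unfolding g[symmetric] by (simp add: cmat_assoc sP)
  have 2: "s ** adj (P0 ** drift H hs ** P0) = s ** adj (drift H hs)"
    unfolding g[symmetric] by (simp add: adj_mult D matrix_mul_assoc sP)
  have "P0 ** h ** P0 ** s ** adj (P0 ** h ** P0) = h ** s ** adj h" if "h \<in> set hs" for h
    unfolding h[OF that, symmetric] by (simp add: adj_mult D cmat_assoc sP sP')
  then have "(\<Sum>h\<leftarrow>hs. P0 ** h ** P0 ** s ** adj (P0 ** h ** P0)) = (\<Sum>h\<leftarrow>hs. h ** s ** adj h)"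
    by (intro arg_cong[where f = sum_list] map_cong refl)
  then show ?thesis
    unfolding lindblad_drift[OF H] lindblad_drift[OF K] drift 1 2 by (simp add: o_def)
qed

lemma eigspace_on_cong: "(\<And>s. s \<in> M \<Longrightarrow> D s = D' s) \<Longrightarrow> eigspace_on D M lam = eigspace_on D' M lam"
  by (auto simp: eigspace_on_def)

lemma eigval_on_cong: "(\<And>s. s \<in> M \<Longrightarrow> D s = D' s) \<Longrightarrow> eigval_on D M lam = eigval_on D' M lam"
  by (auto simp: eigval_on_def)

lemma mat_range_subset:
  assumes "orth_proj P" "mat_range A \<subseteq> mat_range P" shows "P ** A = A"
proof -
  have "P *v (A *v x) = A *v x" for x
  proof -
    obtain y where "A *v x = P *v y" using assms(2) by (auto simp: mat_range_def)
    then show ?thesis by (simp add: matrix_vector_mul_assoc orth_projD[OF assms(1)])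
  qed
  then show ?thesis by (simp add: matrix_eq matrix_vector_mul_assoc[symmetric])
qed

section \<open>The compressed operators and the basins in the setting of the theorem\<close>

locale basin_decomposition =
  fixes H P0 :: "'n::finite cmat"
    and hs :: "'n cmat list"
    and J :: "'b set"
    and P :: "'b \<Rightarrow> 'n cmat"
  assumes herm: "adj H = H"
    and P0_proj: "orth_proj P0"
    and P0_range: "mat_range P0 =
          span (\<Union>{mat_range \<rho> |\<rho>. density \<rho> \<and> lindblad H hs \<rho> = 0})"
    and J_fin: "finite J"
    and basins: "\<forall>j\<in>J. minimal_collecting H hs (P j)"
    and orth: "\<forall>j\<in>J. \<forall>l\<in>J. j \<noteq> l \<longrightarrow> P j ** P l = 0"
    and sum_P: "(\<Sum>j\<in>J. P j) = P0"
begin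

definition "K = P0 ** H ** P0"

definition "As = map (\<lambda>h. P0 ** h ** P0) hs"

lemma P_proj: "j \<in> J \<Longrightarrow> orth_proj (P j)"
  using basins minimal_collectingD(1) by blast

lemma P_P0: assumes "j \<in> J" shows "P j ** P0 = P j" "P0 ** P j = P j"
proof -
  note D = orth_projD[OF P_proj[OF assms]]
  have "P j ** P0 = (\<Sum>l\<in>J. if l = j then P j else 0)"
    unfolding sum_P[symmetric] cmat_sum_ldistrib
    using orth assms D(2) by (intro sum.cong) auto
  then show *: "P j ** P0 = P j" using assms J_fin by simp
  show "P0 ** P j = P j"
    using arg_cong[OF *, of adj] by (simp add: adj_mult D orth_projD[OF P0_proj])
qed

text \<open>For different j and l, P j A P l = P j P l A P l = 0. So an operator that leaves every
  basin invariant is block diagonal after compression, and invariance becomes commutation.\<close>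

lemma P0_invariant:
  assumes "\<And>j. j \<in> J \<Longrightarrow> A ** P j = P j ** A ** P j"
  shows "A ** P0 = P0 ** A ** P0"
    "\<And>j. j \<in> J \<Longrightarrow> (P0 ** A ** P0) ** P j = P j ** (P0 ** A ** P0)"
proof -
  have 1: "P0 ** A ** P j = A ** P j" if "j \<in> J" for j
    using assms[OF that] P_P0[OF that] by (metis matrix_mul_assoc)
  have "P0 ** A ** P0 = (\<Sum>j\<in>J. P0 ** A ** P j)" by (simp add: sum_P[symmetric] cmat_sum_ldistrib)
  also have "\<dots> = (\<Sum>j\<in>J. A ** P j)" using 1 by (intro sum.cong) auto
  finally show "A ** P0 = P0 ** A ** P0" by (simp add: sum_P[symmetric] cmat_sum_ldistrib)
  fix j assume j: "j \<in> J"
  have "P j ** A ** P l = (if l = j then A ** P j else 0)" if "l \<in> J" for l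
  proof (cases "l = j")
    case False
    have "P j ** A ** P l = (P j ** P l) ** A ** P l"
      using assms[OF that] by (metis matrix_mul_assoc)
    then show ?thesis using orth that j False by auto
  qed (use assms[OF j] in simp)
  then have "P j ** A ** P0 = (\<Sum>l\<in>J. if l = j then A ** P j else 0)"
    unfolding sum_P[symmetric] cmat_sum_ldistrib by (intro sum.cong) auto
  then have "P j ** A ** P0 = A ** P j" using j J_fin by simp
  moreover have "P j ** (P0 ** A ** P0) = P j ** A ** P0"
    by (simp add: matrix_mul_assoc P_P0[OF j])
  moreover have "(P0 ** A ** P0) ** P j = P0 ** A ** P j"
    by (simp add: cmat_assoc P_P0[OF j])
  ultimately show "(P0 ** A ** P0) ** P j = P j ** (P0 ** A ** P0)" using 1[OF j] by simp
qed

lemma P_invariant: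
  assumes "j \<in> J"
  shows "h \<in> set hs \<Longrightarrow> h ** P j = P j ** h ** P j"
    "drift H hs ** P j = P j ** drift H hs ** P j"
  using assms basins minimal_collectingD(2) block_invariant_iff[OF herm] by blast+

lemmas h_P0 = P0_invariant(1)[OF P_invariant(1)]
lemmas drift_P0 = P0_invariant(1)[OF P_invariant(2)]

lemma compressed_drift': "drift K As = P0 ** drift H hs ** P0"
  unfolding K_def As_def by (rule compressed_drift[OF P0_proj h_P0])

lemma compressed_lindblad':
  assumes "s = P0 ** s ** P0" shows "lindblad K As s = lindblad H hs s"
  unfolding K_def As_def
  by (rule compressed_lindblad[OF herm P0_proj h_P0 drift_P0 assms])

lemma lindblad_block:
  assumes "j \<in> J" "l \<in> J" "s \<in> block (P j) (P l)"
  shows "lindblad H hs s = lindblad K As s"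
proof -
  have "s = P j ** s ** P l" using assms(3) by (simp add: block_def)
  then have "s = P0 ** s ** P0"
    using P_P0[OF assms(1)] P_P0[OF assms(2)] by (metis matrix_mul_assoc)
  then show ?thesis by (simp add: compressed_lindblad')
qed

lemma K_herm: "adj K = K"
  by (simp add: K_def adj_mult herm orth_projD[OF P0_proj] cmat_assoc)

text \<open>The Hamiltonian is the antihermitian part of the drift, so it inherits the commutation
  with the basin projections.\<close>

lemma reduces_P:
  assumes j: "j \<in> J" shows "reduces (P j) K As"
  unfolding reduces_def
proof (intro conjI ballI)
  note D = orth_projD[OF P_proj[OF j]]
  define G where "G = drift K As"
  have "G ** P j = P j ** G"
    unfolding G_def compressed_drift' by (rule P0_invariant(2)[OF P_invariant(2) j])
  moreover from commute_adj[OF this] have "adj G ** P j = P j ** adj G" by (simp add: D)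
  moreover have "K = csc (\<i> / 2) (G - adj G)"
  proof -
    have "adj (\<Sum>h\<leftarrow>hs'. adj h ** h) = (\<Sum>h\<leftarrow>hs'. adj h ** h)" for hs' :: "'n cmat list"
      by (induction hs') (simp_all add: adj_add adj_mult)
    then show ?thesis
      by (simp add: G_def drift_def adj_diff adj_csc K_herm csc_diff csc_add) (simp add: vec_eq_iff)
  qed
  ultimately show "K ** P j = P j ** K" by (simp add: cmat_expand)
  fix A assume "A \<in> set As"
  then obtain h where "h \<in> set hs" "A = P0 ** h ** P0" by (auto simp: As_def)
  then show "A ** P j = P j ** A"
    using P0_invariant(2)[OF P_invariant(1) j] by simp
qed (auto simp: K_herm P_proj[OF j])

text \<open>For a projection Q below \<open>P j\<close> the original and the compressed generator
  agree on the corner of Q, so both have the same collecting subspaces inside the basin.\<close>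

lemma minimal_P:
  assumes j: "j \<in> J" shows "minimal_collecting K As (P j)"
proof -
  have eq: "collecting K As Q \<longleftrightarrow> collecting H hs Q" if "P j ** Q = Q" for Q
  proof (cases "orth_proj Q")
    case True
    have 1: "P0 ** Q = Q" using that P_P0[OF j] by (metis matrix_mul_assoc)
    have 2: "Q ** P0 = Q" using orth_proj_diff(2)[OF P0_proj True 1] .
    have "lindblad K As (Q ** s ** Q) = lindblad H hs (Q ** s ** Q)" for s
      by (rule compressed_lindblad') (simp add: matrix_mul_assoc 1, simp add: cmat_assoc 2)
    then show ?thesis by (simp add: collecting_iff block_invariant_def)
  qed (simp add: collecting_def)
  have "minimal_collecting H hs (P j)" using basins j by blast
  then show ?thesis
    unfolding minimal_collecting_def
    using eq mat_range_subset[OF P_proj[OF j]] orth_projD(2)[OF P_proj[OF j]] by metis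
qed

text \<open>If \<open>P j\<close> annihilated every stationary density, it would annihilate their
  span, the range of \<open>P0\<close>, and so P j = P j ** P0 = 0. Hence some stationary density
  meets the basin; its corner is again stationary for the compressed generator, positive and
  nonzero, and is normalised by its trace.\<close>

lemma stationary_state:
  assumes j: "j \<in> J"
  obtains R where "density R" "lindblad K As R = 0" "R = P j ** R ** P j"
proof -
  note D = orth_projD[OF P_proj[OF j]]
  have "\<exists>\<rho>. density \<rho> \<and> lindblad H hs \<rho> = 0 \<and> \<rho> ** P j \<noteq> 0"
  proof (rule ccontr)
    assume no: "\<not> ?thesis"
    have "P j *v x = 0" if "x \<in> mat_range \<rho>" "density \<rho>" "lindblad H hs \<rho> = 0" for x \<rho>
    proof -
      have "\<rho> ** P j = 0" using no that by blast
      from arg_cong[OF this, of adj] have "P j ** \<rho> = 0"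
        using that(2) by (simp add: adj_mult D density_iff psd_def)
      then show ?thesis using that(1) by (auto simp: mat_range_def matrix_vector_mul_assoc)
    qed
    then have "(\<Union>{mat_range \<rho> |\<rho>. density \<rho> \<and> lindblad H hs \<rho> = 0}) \<subseteq> {x. P j *v x = 0}"
      by blast
    moreover have "subspace {x. P j *v x = 0}"
      by (auto simp: subspace_def matrix_vector_right_distrib matrix_vector_scaleR)
    ultimately have "mat_range P0 \<subseteq> {x. P j *v x = 0}"
      unfolding P0_range by (rule span_minimal)
    then have "P j *v (P0 *v x) = 0" for x by (auto simp: mat_range_def)
    then have "P j ** P0 = 0" by (simp add: matrix_eq matrix_vector_mul_assoc)
    then show False
      using P_P0[OF j] minimal_collectingD(3)[OF minimal_P[OF j]] by simp
  qed
  then obtain \<rho> where \<rho>: "density \<rho>" "lindblad H hs \<rho> = 0" "\<rho> ** P j \<noteq> 0" by blast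
  have "mat_range \<rho> \<subseteq> mat_range P0"
    unfolding P0_range using \<rho> by (blast intro: span_base)
  then have "P0 ** \<rho> = \<rho>" by (rule mat_range_subset[OF P0_proj])
  moreover from arg_cong[OF this, of adj] have "\<rho> ** P0 = \<rho>"
    using \<rho> by (simp add: adj_mult orth_projD[OF P0_proj] density_iff psd_def)
  ultimately have "\<rho> = P0 ** \<rho> ** P0" by simp
  then have K\<rho>: "lindblad K As \<rho> = 0" using \<rho> by (simp add: compressed_lindblad')
  define T where "T = P j ** \<rho> ** P j"
  have psd\<rho>: "psd \<rho>" using \<rho> by (simp add: density_iff)
  have T: "psd T" unfolding T_def using psd_congruence[OF psd\<rho>, of "P j"] D by simp
  have KT: "lindblad K As T = 0"
    unfolding T_def reduces_lindblad[OF reduces_P[OF j] reduces_P[OF j]] K\<rho> by simp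
  have TP: "T = P j ** T ** P j" by (simp add: T_def matrix_mul_assoc D(2)) (simp add: cmat_assoc D)
  have "T \<noteq> 0"
  proof
    assume "T = 0"
    then have "inner (P j ** \<rho> ** P j) (mat 1) = 0" by (simp add: T_def)
    then have "inner \<rho> (P j ** adj (P j)) = 0" by (simp add: inner_block D)
    then show False using psd_kernel_matrix[OF psd\<rho>] \<rho>(3) by blast
  qed
  then have tr: "Re (trace T) \<noteq> 0" using psd_trace_0[OF T] by blast
  then have pos: "Re (trace T) > 0" using psd_trace_nonneg[OF T] by simp
  have trT: "trace T = of_real (Re (trace T))"
    using T by (intro trace_hermitian_real) (simp add: psd_def)
  define a where "a = 1 / Re (trace T)"
  define R where "R = a *\<^sub>R T"
  have "a *\<^sub>R T *v x = a *\<^sub>R (T *v x)" for x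
    by (simp add: vec_eq_iff matrix_vector_mult_def scaleR_sum_right)
  then have "psd R"
    using T pos by (simp add: psd_def R_def a_def) (simp add: scaleR_csc adj_csc)
  moreover have "trace R = 1"
    unfolding R_def scaleR_csc trace_csc
    by (subst trT) (use tr in \<open>simp add: a_def flip: of_real_mult\<close>)
  ultimately have "density R" by (simp add: density_iff)
  moreover have "lindblad K As R = 0" by (simp add: R_def scaleR_csc lindblad_csc KT)
  moreover have "R = P j ** R ** P j"
    using TP[symmetric] by (simp add: R_def scaleR_csc cmat_expand)
  ultimately show thesis by (rule that)
qed

lemma basin_P: "j \<in> J \<Longrightarrow> basin K As (P j)"
  unfolding basin_def using minimal_P reduces_P stationary_state by metis

lemma stationary_block_iff:
  assumes "j \<in> J"
  shows "density R \<and> lindblad H hs R = 0 \<and> R = P j ** R ** P j \<longleftrightarrow>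
    density R \<and> lindblad K As R = 0 \<and> R = P j ** R ** P j"
  using lindblad_block[OF assms assms, of R] by (auto simp: block_def)

lemma block_spectrum:
  assumes j: "j \<in> J" and l: "l \<in> J" and I: "intertwiner K As (P j) (P l) \<omega> V"
  shows "\<And>R. density R \<and> lindblad H hs R = 0 \<and> R = P j ** R ** P j \<Longrightarrow>
      eigspace_on (lindblad H hs) (block (P j) (P l)) (\<i> * of_real \<omega>) = {csc c (R ** V) |c. True}"
    and "\<And>lam. eigval_on (lindblad H hs) (block (P j) (P l)) lam \<Longrightarrow> lam \<noteq> \<i> * of_real \<omega> \<Longrightarrow> Re lam < 0"
proof -
  have e: "eigspace_on (lindblad H hs) (block (P j) (P l)) lam =
      eigspace_on (lindblad K As) (block (P j) (P l)) lam"
    "eigval_on (lindblad H hs) (block (P j) (P l)) lam =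
      eigval_on (lindblad K As) (block (P j) (P l)) lam" for lam
    using lindblad_block[OF j l] by (intro eigspace_on_cong eigval_on_cong; blast)+
  note b = basin_P[OF j] basin_P[OF l]
  show "eigspace_on (lindblad H hs) (block (P j) (P l)) (\<i> * of_real \<omega>) = {csc c (R ** V) |c. True}"
    if "density R \<and> lindblad H hs R = 0 \<and> R = P j ** R ** P j" for R
    using that unfolding e(1) stationary_block_iff[OF j] by (intro intertwiner_eigenspace[OF b I]) blast+
  show "Re lam < 0"
    if "eigval_on (lindblad H hs) (block (P j) (P l)) lam" "lam \<noteq> \<i> * of_real \<omega>" for lam
    using that unfolding e(2) by (rule intertwiner_eigenvalues[OF b I])
qed

text \<open>This makes item 1 the diagonal case of the same spectral statement as items 2 and
  3.\<close>

lemma self_intertwiner: "j \<in> J \<Longrightarrow> intertwiner K As (P j) (P j) 0 (P j)"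
  using reducesD[OF reduces_P, of j] by (auto simp: intertwiner_def)

lemma commuting_unitary_intertwiner:
  assumes j: "j \<in> J" and l: "l \<in> J" and U: "unitary_on P0 U" "U ** K = K ** U"
    "\<forall>h\<in>set hs. U ** (P0 ** h ** P0) = (P0 ** h ** P0) ** U" "U ** P l = P j ** U"
  shows "intertwiner K As (P j) (P l) 0 (U ** P l)"
proof (rule unitary_intertwiner[OF reduces_P[OF j] reduces_P[OF l] U(1) P_P0(1)[OF j] P_P0(1)[OF l] U(4)])
  show "U ** h = h ** U" if "h \<in> set As" for h using U(3) that by (auto simp: As_def)
  show "K ** (U ** P l) - U ** P l ** K = csc (of_real (- 0)) (U ** P l)"
  proof -
    have "K ** (U ** P l) = U ** P l ** K"
      using U(2) reducesD(6)[OF reduces_P[OF l]] by (metis matrix_mul_assoc)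
    then show ?thesis by simp
  qed
qed

text \<open>The commutator of K with U equals that of the energy term N. On U ** P j, N contributes
  \<open>El\<close> from the left and \<open>Ej\<close> from the right. This intertwiner runs from j
  to l, and the adjoint reverses both its direction and its sign.\<close>

lemma shifted_unitary_intertwiner:
  assumes j: "j \<in> J" and l: "l \<in> J" and "j \<noteq> l" and U: "unitary_on P0 U"
    "U ** (K - (csc (of_real Ej) (P j) + csc (of_real El) (P l))) =
      (K - (csc (of_real Ej) (P j) + csc (of_real El) (P l))) ** U"
    "\<forall>h\<in>set hs. U ** (P0 ** h ** P0) = (P0 ** h ** P0) ** U" "U ** P j = P l ** U"
  shows "intertwiner K As (P j) (P l) (El - Ej) (P j ** adj U)"
proof -
  note jD = reducesD[OF reduces_P[OF j]] and lD = reducesD[OF reduces_P[OF l]]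
  have jl: "P l ** P j = 0" using orth j l \<open>j \<noteq> l\<close> by auto
  define N where "N = csc (of_real Ej) (P j) + csc (of_real El) (P l)"
  have KU: "K ** U - U ** K = N ** U - U ** N"
    using U(2) unfolding N_def[symmetric] by (simp add: cmat_expand algebra_simps)
  have UN: "U ** N ** P j = csc (of_real Ej) (U ** P j)"
    by (simp add: N_def cmat_expand cmat_assoc jD jl)
  have "N ** (U ** P j) = csc (of_real El) (U ** P j)"
    unfolding U(4) using orth j l \<open>j \<noteq> l\<close>
    by (simp add: N_def cmat_expand matrix_mul_assoc lD(4))
  moreover have "K ** (U ** P j) - (U ** P j) ** K = (K ** U - U ** K) ** P j"
    by (simp add: cmat_expand cmat_assoc jD(6))
  ultimately have "K ** (U ** P j) - (U ** P j) ** K = csc (of_real (- (Ej - El))) (U ** P j)"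
    unfolding KU cmat_diff_rdistrib UN by (simp add: cmat_assoc) (simp add: vec_eq_iff algebra_simps)
  then have "intertwiner K As (P l) (P j) (Ej - El) (U ** P j)"
    by (intro unitary_intertwiner[OF reduces_P[OF l] reduces_P[OF j] U(1) P_P0(1)[OF l] P_P0(1)[OF j] U(4)])
      (use U(3) in \<open>auto simp: As_def\<close>)
  from intertwiner_adj[OF K_herm lD(3) jD(3) this] show ?thesis by (simp add: adj_mult jD)
qed

text \<open>V + adj V exchanges the two basins and the remaining term is the identity on the rest of
  \<open>P0\<close>, so U is self-adjoint with square \<open>P0\<close>. The energies 0 and \<omega>
  compensate the commutator of K with V and with adj V, which have opposite signs.\<close>

lemma unitary_of_intertwiner:
  assumes j: "j \<in> J" and l: "l \<in> J" and "j \<noteq> l" and I: "intertwiner K As (P j) (P l) \<omega> V"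
  defines "U \<equiv> V + adj V + (P0 - P j - P l)"
  shows "unitary_on P0 U"
    "U ** (K - (csc (of_real 0) (P j) + csc (of_real \<omega>) (P l))) =
      (K - (csc (of_real 0) (P j) + csc (of_real \<omega>) (P l))) ** U"
    "\<forall>h\<in>set hs. U ** (P0 ** h ** P0) = (P0 ** h ** P0) ** U" "U ** P j = P l ** U"
proof -
  note jD = reducesD[OF reduces_P[OF j]] and lD = reducesD[OF reduces_P[OF l]]
  note P0D = orth_projD[OF P0_proj]
  have jl: "P l ** P j = 0" "P j ** P l = 0" using orth j l \<open>j \<noteq> l\<close> by auto
  have V: "V = P j ** V ** P l" "adj V ** V = P l" "V ** adj V = P j"
    "\<And>h. h \<in> set As \<Longrightarrow> h ** V = V ** h" "\<And>h. h \<in> set As \<Longrightarrow> adj h ** V = V ** adj h"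
    "K ** V - V ** K = csc (of_real (- \<omega>)) V"
    using I unfolding intertwiner_def by blast+
  have jV: "P j ** V = V" "V ** P l = V" using V(1) jD(4) lD(4) by (metis matrix_mul_assoc)+
  have V': "adj V ** P j = adj V" "P l ** adj V = adj V"
    using arg_cong[OF jV(1), of adj] arg_cong[OF jV(2), of adj] by (simp_all add: adj_mult jD lD)
  have z: "V ** P j = 0" "P l ** V = 0" "adj V ** P l = 0" "P j ** adj V = 0" "V ** V = 0" "adj V ** adj V = 0"
    using jV V' jl by (metis cmat_mult_zero matrix_mul_assoc)+
  have V0: "V ** P0 = V" "P0 ** V = V" "adj V ** P0 = adj V" "P0 ** adj V = adj V"
    using jV V' P_P0[OF j] P_P0[OF l] by (metis matrix_mul_assoc)+
  note simps = cmat_expand jV V' z V0 V(2,3) jl jD(3,4) lD(3,4) P_P0[OF j] P_P0[OF l] P0D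
  have UU: "U ** U = P0" by (simp add: U_def simps)
  have adjU: "adj U = U" by (simp add: U_def simps)
  show "unitary_on P0 U" by (simp add: unitary_on_def adjU UU)
  have Uj: "U ** P j = adj V" by (simp add: U_def simps)
  moreover have lU: "P l ** U = adj V" by (simp add: U_def simps)
  ultimately show "U ** P j = P l ** U" by simp
  have Ul: "U ** P l = V" "P j ** U = V" by (simp_all add: U_def simps)
  have VK: "adj V ** K - K ** adj V = csc (of_real (- \<omega>)) (adj V)"
    using arg_cong[OF V(6), of adj] by (simp add: cmat_expand K_herm)
  have KP0: "K ** P0 = K" "P0 ** K = K" by (simp_all add: K_def cmat_assoc P0D)
  have "K ** U - U ** K = (K ** V - V ** K) - (adj V ** K - K ** adj V)"
    by (simp add: U_def cmat_expand KP0 jD(6) lD(6))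
  also have "\<dots> = csc (of_real \<omega>) (adj V) - csc (of_real \<omega>) V"
    unfolding V(6) VK by (simp add: vec_eq_iff)
  finally show "U ** (K - (csc (of_real 0) (P j) + csc (of_real \<omega>) (P l))) =
      (K - (csc (of_real 0) (P j) + csc (of_real \<omega>) (P l))) ** U"
    by (simp add: cmat_diff_ldistrib cmat_diff_rdistrib csc_mult_left csc_mult_right Ul lU algebra_simps)
  show "\<forall>h\<in>set hs. U ** (P0 ** h ** P0) = (P0 ** h ** P0) ** U"
  proof
    fix h assume h: "h \<in> set hs"
    define A where "A = P0 ** h ** P0"
    have A: "A \<in> set As" using h by (auto simp: A_def As_def)
    have A0: "A ** P0 = A" "P0 ** A = A" by (simp_all add: A_def cmat_assoc P0D)
    have "adj V ** A = A ** adj V" using commute_adj[OF V(5)[OF A]] by simp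
    then have "U ** A = A ** U"
      using V(4)[OF A] by (simp add: U_def cmat_expand A0 jD(8)[OF A] lD(8)[OF A])
    then show "U ** (P0 ** h ** P0) = (P0 ** h ** P0) ** U" by (simp add: A_def)
  qed
qed

end

section \<open>The four items, read off from intertwiners between basins\<close>

theorem mainTheorem13:
  fixes H P0 :: "'n::finite cmat"
    and hs :: "'n cmat list"
    and J :: "'b set"
    and P :: "'b \<Rightarrow> 'n cmat"
  assumes herm: "adj H = H"
    and P0_proj: "orth_proj P0"
    and P0_range: "mat_range P0 =
          span (\<Union>{mat_range \<rho> |\<rho>. density \<rho> \<and> lindblad H hs \<rho> = 0})"
    and J_fin: "finite J"
    and basins: "\<forall>j\<in>J. minimal_collecting H hs (P j)"
    and orth: "\<forall>j\<in>J. \<forall>l\<in>J. j \<noteq> l \<longrightarrow> P j ** P l = 0"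
    and sum_P: "(\<Sum>j\<in>J. P j) = P0"
  shows
    \<comment> \<open>item 1\<close>
    "(\<forall>j\<in>J. (\<exists>\<rho>. density \<rho> \<and> lindblad H hs \<rho> = 0 \<and> \<rho> = P j ** \<rho> ** P j) \<and>
        (\<forall>\<rho>. density \<rho> \<and> lindblad H hs \<rho> = 0 \<and> \<rho> = P j ** \<rho> ** P j \<longrightarrow>
           eigspace_on (lindblad H hs) (block (P j) (P j)) 0 = {csc c \<rho> |c. True}) \<and>
        (\<forall>lam. eigval_on (lindblad H hs) (block (P j) (P j)) lam \<and> lam \<noteq> 0 \<longrightarrow> Re lam < 0))
   \<and>
    \<comment> \<open>item 2\<close>
    (\<forall>j\<in>J. \<forall>l\<in>J. \<forall>U. j \<noteq> l \<and> unitary_on P0 U \<and>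
        U ** (P0 ** H ** P0) = (P0 ** H ** P0) ** U \<and>
        (\<forall>h\<in>set hs. U ** (P0 ** h ** P0) = (P0 ** h ** P0) ** U) \<and>
        U ** P l = P j ** U \<and> U ** U = P0 \<longrightarrow>
        (\<forall>\<rho>. density \<rho> \<and> lindblad H hs \<rho> = 0 \<and> \<rho> = P j ** \<rho> ** P j \<longrightarrow>
           eigspace_on (lindblad H hs) (block (P j) (P l)) 0 = {csc c (\<rho> ** U) |c. True}) \<and>
        (\<forall>lam. eigval_on (lindblad H hs) (block (P j) (P l)) lam \<and> lam \<noteq> 0 \<longrightarrow> Re lam < 0))
   \<and>
    \<comment> \<open>item 3\<close>
    (\<forall>j\<in>J. \<forall>l\<in>J. \<forall>U Ej El. j \<noteq> l \<and> unitary_on P0 U \<and>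
        U ** (P0 ** H ** P0 - (csc (of_real Ej) (P j) + csc (of_real El) (P l))) =
          (P0 ** H ** P0 - (csc (of_real Ej) (P j) + csc (of_real El) (P l))) ** U \<and>
        (\<forall>h\<in>set hs. U ** (P0 ** h ** P0) = (P0 ** h ** P0) ** U) \<and>
        U ** P j = P l ** U \<longrightarrow>
        (\<forall>\<rho>. density \<rho> \<and> lindblad H hs \<rho> = 0 \<and> \<rho> = P j ** \<rho> ** P j \<longrightarrow>
           eigspace_on (lindblad H hs) (block (P j) (P l)) (\<i> * of_real (El - Ej))
             = {csc c (\<rho> ** adj U) |c. True}) \<and>
        (\<forall>lam. eigval_on (lindblad H hs) (block (P j) (P l)) lam \<and>
              lam \<noteq> \<i> * of_real (El - Ej) \<longrightarrow> Re lam < 0))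
   \<and>
    \<comment> \<open>item 4\<close>
    (\<forall>j\<in>J. \<forall>l\<in>J. j \<noteq> l \<and>
        \<not> (\<exists>U. unitary_on P0 U \<and>
              U ** (P0 ** H ** P0) = (P0 ** H ** P0) ** U \<and>
              (\<forall>h\<in>set hs. U ** (P0 ** h ** P0) = (P0 ** h ** P0) ** U) \<and>
              U ** P l = P j ** U \<and> U ** U = P0) \<and>
        \<not> (\<exists>U Ej El. unitary_on P0 U \<and>
              U ** (P0 ** H ** P0 - (csc (of_real Ej) (P j) + csc (of_real El) (P l))) =
                (P0 ** H ** P0 - (csc (of_real Ej) (P j) + csc (of_real El) (P l))) ** U \<and>
              (\<forall>h\<in>set hs. U ** (P0 ** h ** P0) = (P0 ** h ** P0) ** U) \<and>
              U ** P j = P l ** U) \<longrightarrow>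
        (\<forall>lam. eigval_on (lindblad H hs) (block (P j) (P l)) lam \<longrightarrow> Re lam < 0))"
proof -
  interpret basin_decomposition H P0 hs J P
    using assms by unfold_locales
  show ?thesis
  proof (intro conjI ballI allI impI; (elim conjE)?)
    fix j assume j: "j \<in> J"
    note self = block_spectrum[OF j j self_intertwiner[OF j]]
    show "\<exists>\<rho>. density \<rho> \<and> lindblad H hs \<rho> = 0 \<and> \<rho> = P j ** \<rho> ** P j"
      using stationary_state[OF j] stationary_block_iff[OF j] by metis
    show "eigspace_on (lindblad H hs) (block (P j) (P j)) 0 = {csc c \<rho> |c. True}"
      if "density \<rho>" "lindblad H hs \<rho> = 0" "\<rho> = P j ** \<rho> ** P j" for \<rho>
    proof -
      have "\<rho> ** P j = \<rho>" using that(3) orth_projD(2)[OF P_proj[OF j]] by (metis matrix_mul_assoc)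
      then show ?thesis using self(1)[of \<rho>] that by simp
    qed
    show "Re lam < 0"
      if "eigval_on (lindblad H hs) (block (P j) (P j)) lam" "lam \<noteq> 0" for lam
      using self(2)[of lam] that by simp
  next
    fix j l U
    assume jl: "j \<in> J" "l \<in> J" "j \<noteq> l" and "unitary_on P0 U"
      "U ** (P0 ** H ** P0) = P0 ** H ** P0 ** U"
      "\<forall>h\<in>set hs. U ** (P0 ** h ** P0) = P0 ** h ** P0 ** U" and Ul: "U ** P l = P j ** U"
    then have "intertwiner K As (P j) (P l) 0 (U ** P l)"
      by (intro commuting_unitary_intertwiner) (auto simp: K_def)
    note spec = block_spectrum[OF jl(1,2) this]
    show "eigspace_on (lindblad H hs) (block (P j) (P l)) 0 = {csc c (\<rho> ** U) |c. True}"
      if "density \<rho>" "lindblad H hs \<rho> = 0" "\<rho> = P j ** \<rho> ** P j" for \<rho>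
    proof -
      \<comment> \<open>The spectral lemma gives \<rho> times U ** P l; the projection moves through
        U as \<open>P j\<close> and is absorbed by \<rho>.\<close>
      have "\<rho> ** P j = \<rho>" using that(3) orth_projD(2)[OF P_proj[OF jl(1)]] by (metis matrix_mul_assoc)
      then have "\<rho> ** (U ** P l) = \<rho> ** U" by (simp add: Ul matrix_mul_assoc)
      then show ?thesis using spec(1)[of \<rho>] that by simp
    qed
    show "Re lam < 0"
      if "eigval_on (lindblad H hs) (block (P j) (P l)) lam" "lam \<noteq> 0" for lam
      using spec(2)[of lam] that by simp
  next
    fix j l U Ej El
    assume jl: "j \<in> J" "l \<in> J" "j \<noteq> l" and "unitary_on P0 U"
      "U ** (P0 ** H ** P0 - (csc (of_real Ej) (P j) + csc (of_real El) (P l))) =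
        (P0 ** H ** P0 - (csc (of_real Ej) (P j) + csc (of_real El) (P l))) ** U"
      "\<forall>h\<in>set hs. U ** (P0 ** h ** P0) = P0 ** h ** P0 ** U" "U ** P j = P l ** U"
    then have "intertwiner K As (P j) (P l) (El - Ej) (P j ** adj U)"
      by (intro shifted_unitary_intertwiner) (auto simp: K_def)
    note spec = block_spectrum[OF jl(1,2) this]
    show "eigspace_on (lindblad H hs) (block (P j) (P l)) (\<i> * of_real (El - Ej)) =
        {csc c (\<rho> ** adj U) |c. True}"
      if "density \<rho>" "lindblad H hs \<rho> = 0" "\<rho> = P j ** \<rho> ** P j" for \<rho>
    proof -
      have "\<rho> ** P j = \<rho>" using that(3) orth_projD(2)[OF P_proj[OF jl(1)]] by (metis matrix_mul_assoc)
      then show ?thesis using spec(1)[of \<rho>] that by (simp add: matrix_mul_assoc)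
    qed
    show "Re lam < 0"
      if "eigval_on (lindblad H hs) (block (P j) (P l)) lam" "lam \<noteq> \<i> * of_real (El - Ej)" for lam
      using spec(2)[of lam] that by simp
  next
    fix j l lam
    assume jl: "j \<in> J" "l \<in> J" "j \<noteq> l"
      and no: "\<not> (\<exists>U Ej El. unitary_on P0 U \<and>
          U ** (P0 ** H ** P0 - (csc (of_real Ej) (P j) + csc (of_real El) (P l))) =
            (P0 ** H ** P0 - (csc (of_real Ej) (P j) + csc (of_real El) (P l))) ** U \<and>
          (\<forall>h\<in>set hs. U ** (P0 ** h ** P0) = (P0 ** h ** P0) ** U) \<and>
          U ** P j = P l ** U)"
      and ev: "eigval_on (lindblad H hs) (block (P j) (P l)) lam"
    obtain s where "s \<in> block (P j) (P l)" "s \<noteq> 0" "lindblad H hs s = csc lam s"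
      using ev by (auto simp: eigval_on_def)
    then have s: "s = P j ** s ** P l" "s \<noteq> 0" "lindblad K As s = csc lam s"
      using lindblad_block[OF jl(1,2)] by (auto simp: block_def)
    show "Re lam < 0"
    proof (rule ccontr)
      assume "\<not> Re lam < 0"
      then obtain \<omega> V where "intertwiner K As (P j) (P l) \<omega> V"
        using eigenvalue_intertwiner[OF basin_P basin_P s] jl by (meson not_less)
      \<comment> \<open>The rebuilt unitary has the form of item 3 for every frequency, including
        \<omega> = 0.\<close>
      from unitary_of_intertwiner[OF jl this] show False
        using no unfolding K_def by blast
    qed
  qed
qed

end
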